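(* Let $p$ be a prime number, let $L_q\in E_{\mathbb{Z},q,p}[\sigma_q]$ be a (monic) $q$-difference operator of order $n$, and let $f(q,z)\in\mathbb{Z}_{q,p}[[z]]$ be a solution of $L_q$. Suppose that $L_q$ has a strong Frobenius structure with period $h$. Then there exist $d_0(q,z),\ldots,d_{n^2}(q,z)\in\vartheta_{\mathrm{Frac}(\mathbb{Z}_{q,p})}[[z]]$ and a nonzero constant $c\in\mathbb{Z}_{q,p}$ such that: (a) the polynomial $d_0(q,z)Y_0+d_1(q,z)Y_1+\cdots+d_{n^2}(q,z)Y_{n^2}$ is not zero modulo $\phi_p(q)\vartheta_{\mathrm{Frac}(\mathbb{Z}_{q,p})}$, i.e. not all of the $d_i(q,z)$ lie in $\phi_p(q)\vartheta_{\mathrm{Frac}(\mathbb{Z}_{q,p})}[[z]]$; (b) $c\,d_0(q,z),\ldots,c\,d_{n^2}(q,z)\in E_{\mathbb{Z},q,p}$; (c) $\displaystyle\sum_{i=0}^{n^2}d_i(q,z)\,\mathbf{F}_q^{ih}(f(q,z))\equiv0\bmod\phi_p(q)\vartheta_{\mathrm{Frac}(\mathbb{Z}_{q,p})}[[z]].$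
   Context: Fix a prime $p$ and a variable $q$; $\phi_p(q)=1+q+\cdots+q^{p-1}$. Let $\mathfrak{m}=(p,1-q)\subset\mathbb{Z}[q]$. For nonzero $x\in\mathbb{Z}[q]$ there is a unique integer $n\ge0$ with $x\in\mathfrak{m}^n\setminus\mathfrak{m}^{n+1}$; put $|x|_{\mathfrak{m}}=p^{-n}$, and $|0|_{\mathfrak{m}}=0$. This is a (multiplicative) ultrametric absolute value; it extends to $\mathbb{Q}(q)$. $\mathbb{Z}[q]_{\mathfrak{m}}$ is the localization of $\mathbb{Z}[q]$ at $\mathfrak{m}$, and $\mathbb{Z}_{q,p}$ is its completion for $|\cdot|_{\mathfrak{m}}$ (an integral domain). The absolute value extends multiplicatively to the fraction field $\mathrm{Frac}(\mathbb{Z}_{q,p})$, and $\vartheta_{\mathrm{Frac}(\mathbb{Z}_{q,p})}=\{x\in\mathrm{Frac}(\mathbb{Z}_{q,p}):|x|_{\mathfrak{m}}\le1\}$. $\mathbf{F}_q:\mathbb{Z}_{q,p}\to\mathbb{Z}_{q,p}$ is the continuous ring endomorphism extending $P(q)/Q(q)\mapsto P(q^p)/Q(q^p)$. $\mathbb{Z}_{q,p}[[z]]$ carries the Gauss norm $|\sum a_nz^n|_{\mathcal G}=\sup_n|a_n|_{\mathfrak{m}}$. Let $S=\{P(z)\in\mathbb{Z}_{q,p}[z]: |P(0)|_{\mathfrak{m}}=1\}$; $\mathbb{Z}_{q,p}[z]_S\subset\mathbb{Z}_{q,p}[[z]]$ is the localization of $\mathbb{Z}_{q,p}[z]$ at $S$,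 and $E_{\mathbb{Z},q,p}\subset\mathbb{Z}_{q,p}[[z]]$ is the completion of $\mathbb{Z}_{q,p}[z]_S$ for the Gauss norm. On $\mathbb{Z}_{q,p}[[z]]$ put $\sigma_q(\sum a_nz^n)=\sum a_nq^nz^n$ and $\mathbf{F}_q(\sum a_nz^n)=\sum\mathbf{F}_q(a_n)z^{np}$; both preserve $E_{\mathbb{Z},q,p}$. An operator of order $n$ is written $L_q=\sigma_q^n+a_1(z)\sigma_q^{n-1}+\cdots+a_{n-1}(z)\sigma_q+a_n(z)$ with $a_i\in E_{\mathbb{Z},q,p}$; $f$ is a solution if $L_qf=0$. Its companion matrix $A_q$ has ones on the superdiagonal, last row $(-a_n,-a_{n-1},\ldots,-a_1)$, zeros elsewhere. $L_q$ has a strong Frobenius structure with period $h$ ($h>0$ an integer) if there is $H_q\in\mathrm{GL}_n(E_{\mathbb{Z},q,p})$ with $\sigma_q(H_q)A_q^{\mathbf{F}_q^h}=A_qH_q$, where $\sigma_q$ is applied entrywise and $A_q^{\mathbf{F}_q^h}$ is obtained by applying $\mathbf{F}_q$ $h$ times to each entry of $A_q$. *)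

theory Defs
  imports
    "HOL-Computational_Algebra.Computational_Algebra"
    "Berlekamp_Zassenhaus.Finite_Field"
    "Jordan_Normal_Form.Matrix"
begin

hide_const (open) UnivPoly.up_ring.coeff UnivPoly.up_ring.monom Module.smult

section \<open>Non-archimedean absolute values and their extension to the fraction field\<close>

locale ultra_abs =
  fixes v :: "'a::comm_ring_1 \<Rightarrow> real"
  assumes nonneg: "0 \<le> v x"
    and zero_iff: "v x = 0 \<longleftrightarrow> x = 0"
    and mult: "v (x * y) = v x * v y"
    and add_le: "v (x + y) \<le> max (v x) (v y)"
begin

lemma zero [simp]: "v 0 = 0"
  by (simp add: zero_iff)

lemma one [simp]: "v 1 = 1"
  using mult[of 1 1] zero_iff[of 1] by simp

lemma minus [simp]: "v (- x) = v x"
proof -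
  have "v (-1) * v (-1) = 1"
    using mult[of "-1" "-1"] by simp
  then have "v (-1) = 1"
    using nonneg[of "-1"] by (metis abs_of_nonneg power2_eq_square power2_eq_1_iff abs_one abs_minus_cancel)
  then show ?thesis
    using mult[of "-1" x] by simp
qed

lemma diff_le: "v (x - y) \<le> max (v x) (v y)"
  using add_le[of x "- y"] by simp

lemma diff_commute: "v (x - y) = v (y - x)"
  using minus[of "x - y"] by simp

lemma diff_triangle: "v (x - z) \<le> max (v (x - y)) (v (y - z))"
  using add_le[of "x - y" "y - z"] by simp

lemma abs_diff_le: "\<bar>v x - v y\<bar> \<le> v (x - y)"
proof -
  have "v x \<le> max (v (x - y)) (v y)" "v y \<le> max (v (x - y)) (v x)"
    using add_le[of "x - y" y] add_le[of "y - x" x] diff_commute[of x y] by simp_all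
  then show ?thesis
    using nonneg[of x] nonneg[of y] nonneg[of "x - y"] by linarith
qed

end

definition fract_abs :: "('a::idom \<Rightarrow> real) \<Rightarrow> 'a fract \<Rightarrow> real" where
  "fract_abs v x = (THE r. \<exists>a b. b \<noteq> 0 \<and> x = Fract a b \<and> r = v a / v b)"

lemma fract_abs_Fract:
  fixes v :: "'a::idom \<Rightarrow> real"
  assumes "ultra_abs v" "b \<noteq> 0"
  shows "fract_abs v (Fract a b) = v a / v b"
  unfolding fract_abs_def
proof (rule the_equality)
  show "\<exists>c d. d \<noteq> 0 \<and> Fract a b = Fract c d \<and> v a / v b = v c / v d"
    using assms by blast
  fix r assume "\<exists>c d. d \<noteq> 0 \<and> Fract a b = Fract c d \<and> r = v c / v d"
  then obtain c d where d: "d \<noteq> 0" "Fract a b = Fract c d" "r = v c / v d" by blast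
  interpret ultra_abs v by fact
  have "a * d = c * b" using d assms by (simp add: eq_fract)
  then have "v a * v d = v c * v b" by (metis mult)
  moreover have "v b \<noteq> 0" "v d \<noteq> 0" using assms d by (simp_all add: zero_iff)
  ultimately show "r = v a / v b" unfolding d(3) by (simp add: frac_eq_eq mult.commute)
qed

lemma ultra_abs_fract_abs:
  fixes v :: "'a::idom \<Rightarrow> real"
  assumes "ultra_abs v"
  shows "ultra_abs (fract_abs v)"
proof
  interpret ultra_abs v by fact
  note F = fract_abs_Fract[OF assms]
  fix x y :: "'a fract"
  obtain a b where x: "x = Fract a b" "b \<noteq> 0" by (cases x) auto
  obtain c d where y: "y = Fract c d" "d \<noteq> 0" by (cases y) auto
  have pos: "v b > 0" "v d > 0"
    using x y nonneg[of b] nonneg[of d] zero_iff[of b] zero_iff[of d] by linarith+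
  show "0 \<le> fract_abs v x" using x by (simp add: F nonneg)
  show "fract_abs v x = 0 \<longleftrightarrow> x = 0"
    using x pos by (simp add: F zero_iff Zero_fract_def eq_fract)
  show "fract_abs v (x * y) = fract_abs v x * fract_abs v y"
    using x y by (simp add: F mult)
  have "v (a * d + c * b) \<le> max (v a * v d) (v c * v b)"
    using add_le[of "a * d" "c * b"] by (simp add: mult)
  also have "\<dots> = max (v a / v b) (v c / v d) * (v b * v d)"
    using pos by (subst max_mult_distrib_right) (simp add: max_def)
  finally show "fract_abs v (x + y) \<le> max (fract_abs v x) (fract_abs v y)"
    using x y pos by (simp add: F mult pos_divide_le_eq)
qed


section \<open>The ideal m = (p, 1 - q) of Z[q] and its absolute value\<close>

abbreviation qvar :: "int poly" where
  "qvar \<equiv> [:0, 1:]"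

definition m_ideal :: "nat \<Rightarrow> int poly set" where
  "m_ideal p = {of_nat p * a + (1 - qvar) * b | a b. True}"

text \<open>Powers of the ideal: as it is generated by \<open>p\<close> and \<open>1 - q\<close>, the product of
  \<open>m_ideal p\<close> with an ideal \<open>I\<close> is \<open>p I + (1 - q) I\<close>.\<close>

primrec m_pow :: "nat \<Rightarrow> nat \<Rightarrow> int poly set" where
  "m_pow p 0 = UNIV"
| "m_pow p (Suc n) = {of_nat p * a + (1 - qvar) * b | a b. a \<in> m_pow p n \<and> b \<in> m_pow p n}"

definition m_abs :: "nat \<Rightarrow> int poly \<Rightarrow> real" where
  "m_abs p x = (if x = 0 then 0
     else 1 / real p ^ (THE n. x \<in> m_pow p n \<and> x \<notin> m_pow p (Suc n)))"

text \<open>Membership in the powers is read off the expansion in powers of \<open>q - 1\<close>.\<close>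

abbreviation shift1 :: "int poly \<Rightarrow> int poly" where
  "shift1 x \<equiv> pcompose x [:1, 1:]"

definition wcond :: "nat \<Rightarrow> nat \<Rightarrow> int poly \<Rightarrow> bool" where
  "wcond p n f \<longleftrightarrow> (\<forall>i<n. int p ^ (n - i) dvd coeff f i)"

lemma shift1_back: "pcompose (shift1 x) [:- 1, 1:] = x"
  by (simp add: pcompose_assoc[symmetric] pcompose_pCons)

lemma shift1_back': "shift1 (pcompose x [:- 1, 1:]) = x"
  by (simp add: pcompose_assoc[symmetric] pcompose_pCons)

lemma shift1_simps:
  "shift1 (of_nat p * a + (1 - qvar) * b) = of_nat p * shift1 a - pCons 0 (shift1 b)"
proof -
  have "shift1 (1 - qvar) * shift1 b = - pCons 0 (shift1 b)"
    by (simp add: pcompose_diff pcompose_pCons one_pCons)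
  moreover have "shift1 (of_nat p) = of_nat p"
    by (simp add: of_nat_poly)
  ultimately show ?thesis
    by (simp only: pcompose_add pcompose_mult add_uminus_conv_diff)
qed

lemma coeff_of_nat_mult: "coeff (of_nat p * f) i = int p * coeff (f :: int poly) i"
  by (simp add: of_nat_poly)

lemma m_pow_iff: "x \<in> m_pow p n \<longleftrightarrow> wcond p n (shift1 x)"
proof (induction n arbitrary: x)
  case 0
  then show ?case by (simp add: wcond_def)
next
  case (Suc n)
  show ?case
  proof
    assume "x \<in> m_pow p (Suc n)"
    then obtain a b where x: "x = of_nat p * a + (1 - qvar) * b"
      and "a \<in> m_pow p n" "b \<in> m_pow p n" by auto
    then have ab: "wcond p n (shift1 a)" "wcond p n (shift1 b)" using Suc by auto
    show "wcond p (Suc n) (shift1 x)"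
      unfolding wcond_def
    proof (intro allI impI)
      fix i assume i: "i < Suc n"
      have 1: "int p ^ (Suc n - i) dvd int p * coeff (shift1 a) i"
      proof (cases "i < n")
        case True
        then have "Suc n - i = Suc (n - i)" by simp
        with True ab(1) show ?thesis unfolding wcond_def by (simp add: mult_dvd_mono)
      next
        case False
        with i have "i = n" by simp
        then show ?thesis by simp
      qed
      have 2: "int p ^ (Suc n - i) dvd coeff (pCons 0 (shift1 b)) i"
      proof (cases i)
        case (Suc j)
        with i ab(2) show ?thesis unfolding wcond_def by simp
      qed simp
      show "int p ^ (Suc n - i) dvd coeff (shift1 x) i"
        unfolding x shift1_simps coeff_diff coeff_of_nat_mult by (rule dvd_diff[OF 1 2])
    qed
  next
    assume w: "wcond p (Suc n) (shift1 x)"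
    obtain c f where cf: "shift1 x = pCons c f" by (cases "shift1 x")
    have "int p ^ (Suc n) dvd c" using w cf unfolding wcond_def by force
    then obtain k where "c = int p ^ Suc n * k" by (rule dvdE)
    then have k: "c = int p * (int p ^ n * k)" by (simp add: mult_ac)
    define a where "a = [:int p ^ n * k:]"
    define b where "b = - pcompose f [:- 1, 1:]"
    have "wcond p n (shift1 a)"
      unfolding a_def wcond_def
    proof (intro allI impI)
      fix i assume "i < n"
      show "int p ^ (n - i) dvd coeff (shift1 [:int p ^ n * k:]) i"
        by (cases i) (simp_all add: pcompose_pCons)
    qed
    moreover have "wcond p n f"
      unfolding wcond_def
    proof (intro allI impI)
      fix i assume "i < n"
      then have "int p ^ (Suc n - Suc i) dvd coeff (shift1 x) (Suc i)"
        using w unfolding wcond_def by blast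
      then show "int p ^ (n - i) dvd coeff f i" using cf by simp
    qed
    then have "wcond p n (shift1 b)"
      unfolding b_def pcompose_uminus shift1_back' by (simp add: wcond_def)
    ultimately have ab: "a \<in> m_pow p n" "b \<in> m_pow p n" using Suc by auto
    have "shift1 x = shift1 (of_nat p * a + (1 - qvar) * b)"
      unfolding shift1_simps cf b_def pcompose_uminus shift1_back' a_def
      by (simp add: k of_nat_poly pcompose_pCons)
    then have "x = of_nat p * a + (1 - qvar) * b" by (metis shift1_back)
    with ab show "x \<in> m_pow p (Suc n)" by auto
  qed
qed

lemma m_pow_add: "x \<in> m_pow p n \<Longrightarrow> y \<in> m_pow p n \<Longrightarrow> x + y \<in> m_pow p n"
  unfolding m_pow_iff wcond_def pcompose_add coeff_add by (blast intro: dvd_add)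

declare m_pow.simps(2) [simp del]

lemma m_pow_SucE:
  assumes "x \<in> m_pow p (Suc n)"
  obtains a b where "x = of_nat p * a + (1 - qvar) * b" "a \<in> m_pow p n" "b \<in> m_pow p n"
  using assms unfolding m_pow.simps(2) by blast

lemma m_pow_SucI:
  "a \<in> m_pow p n \<Longrightarrow> b \<in> m_pow p n \<Longrightarrow> of_nat p * a + (1 - qvar) * b \<in> m_pow p (Suc n)"
  unfolding m_pow.simps(2) by blast

lemma m_pow_mult: "x \<in> m_pow p n \<Longrightarrow> y * x \<in> m_pow p n"
proof (induction n arbitrary: x)
  case (Suc n)
  obtain a b where x: "x = of_nat p * a + (1 - qvar) * b"
    and ab: "a \<in> m_pow p n" "b \<in> m_pow p n" using m_pow_SucE[OF Suc.prems] .
  have "y * x = of_nat p * (y * a) + (1 - qvar) * (y * b)"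
    unfolding x distrib_left by (simp only: mult.left_commute)
  then show ?case using m_pow_SucI[OF Suc.IH[OF ab(1)] Suc.IH[OF ab(2)]] by (simp only:)
qed simp

lemma m_pow_Suc_subset: "m_pow p (Suc n) \<subseteq> m_pow p n"
  by (rule subsetI, elim m_pow_SucE) (simp only: m_pow_add m_pow_mult)

lemma m_pow_antimono: "m \<le> n \<Longrightarrow> m_pow p n \<subseteq> m_pow p m"
  by (rule lift_Suc_antimono_le[of "m_pow p", OF m_pow_Suc_subset])

lemma m_pow_1: "m_pow p (Suc 0) = m_ideal p"
  by (simp add: m_ideal_def m_pow.simps)

context
  fixes p :: nat
  assumes p: "prime p"
begin

lemma m_pow_ex: "x \<noteq> 0 \<Longrightarrow> \<exists>n. x \<in> m_pow p n \<and> x \<notin> m_pow p (Suc n)"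
proof -
  assume "x \<noteq> 0"
  then have "shift1 x \<noteq> 0" by (metis shift1_back pcompose_0)
  then obtain i where i: "coeff (shift1 x) i \<noteq> 0" by (auto simp: poly_eq_iff)
  have "\<not> is_unit (int p)" using p by (metis not_prime_unit prime_nat_int_transfer)
  then obtain k where k: "\<not> int p ^ k dvd coeff (shift1 x) i"
    using finite_divisor_powers[OF i, of "int p"] infinite_UNIV_nat
    by (metis (mono_tags, lifting) UNIV_eq_I mem_Collect_eq)
  then have "k > 0" by (cases k) auto
  then have "x \<notin> m_pow p (i + k)"
    unfolding m_pow_iff wcond_def using k by (auto intro!: exI[of _ i])
  then have ex: "\<exists>n. x \<notin> m_pow p n" by blast
  define N where "N = (LEAST n. x \<notin> m_pow p n)"
  have N: "x \<notin> m_pow p N" unfolding N_def by (rule LeastI_ex[OF ex])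
  then obtain n where n: "N = Suc n" by (cases N) auto
  have "x \<in> m_pow p n"
    using not_less_Least[of n "\<lambda>n. x \<notin> m_pow p n"] n unfolding N_def by auto
  with N n show ?thesis by blast
qed

lemma m_pow_unique:
  assumes "x \<in> m_pow p n" "x \<notin> m_pow p (Suc n)" "x \<in> m_pow p m" "x \<notin> m_pow p (Suc m)"
  shows "n = m"
proof (rule ccontr)
  assume "n \<noteq> m"
  then have "Suc n \<le> m \<or> Suc m \<le> n" by auto
  then show False using assms m_pow_antimono by blast
qed

lemma m_abs_eqI:
  assumes "x \<in> m_pow p n" "x \<notin> m_pow p (Suc n)"
  shows "m_abs p x = 1 / real p ^ n"
proof -
  have "x \<noteq> 0"
  proof
    assume "x = 0"
    then have "x \<in> m_pow p (Suc n)" by (simp only: m_pow_iff wcond_def) simp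
    with assms show False by blast
  qed
  moreover have "(THE n. x \<in> m_pow p n \<and> x \<notin> m_pow p (Suc n)) = n"
    using assms m_pow_unique by blast
  ultimately show ?thesis by (simp only: m_abs_def if_False)
qed

lemma m_abs_cases:
  obtains "x = 0" "m_abs p x = 0"
  | n where "x \<noteq> 0" "x \<in> m_pow p n" "x \<notin> m_pow p (Suc n)" "m_abs p x = 1 / real p ^ n"
  using m_pow_ex[of x] m_abs_eqI[of x] by (cases "x = 0") (auto simp: m_abs_def)

lemma p_gt_1: "real p > 1"
  using p prime_gt_1_nat by simp

lemma m_abs_le_iff: "m_abs p x \<le> 1 / real p ^ n \<longleftrightarrow> x \<in> m_pow p n"
proof (cases x rule: m_abs_cases)
  case 1
  then show ?thesis using p_gt_1 by (simp add: m_pow_iff wcond_def)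
next
  case (2 m)
  have "m_abs p x \<le> 1 / real p ^ n \<longleftrightarrow> real p ^ n \<le> real p ^ m"
    unfolding 2(4) using p_gt_1 by (simp add: field_simps)
  also have "\<dots> \<longleftrightarrow> n \<le> m" using p_gt_1 by simp
  also have "\<dots> \<longleftrightarrow> x \<in> m_pow p n"
    using 2 m_pow_antimono[of n m p] m_pow_antimono[of "Suc m" n p] by (meson not_less_eq_eq subsetD)
  finally show ?thesis .
qed

lemma wcond_mult:
  assumes f: "wcond p n f" "\<not> wcond p (Suc n) f"
    and g: "wcond p m g" "\<not> wcond p (Suc m) g"
  shows "wcond p (n + m) (f * g)" "\<not> wcond p (Suc (n + m)) (f * g)"
proof -
  have P: "prime (int p)" using p by simp
  have fd: "int p ^ (n - i) dvd coeff f i" for i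
    using f(1) unfolding wcond_def by (cases "i < n") auto
  have gd: "int p ^ (m - i) dvd coeff g i" for i
    using g(1) unfolding wcond_def by (cases "i < m") auto
  show "wcond p (n + m) (f * g)"
    unfolding wcond_def coeff_mult
  proof (intro allI impI dvd_sum)
    fix i k assume "i < n + m" "k \<in> {..i}"
    then have "n + m - i \<le> (n - k) + (m - (i - k))" by auto
    then show "int p ^ (n + m - i) dvd coeff f k * coeff g (i - k)"
      using mult_dvd_mono[OF fd gd, of k "i - k"] by (metis power_add power_le_dvd)
  qed
  define i where "i = (LEAST i. i < Suc n \<and> \<not> int p ^ (Suc n - i) dvd coeff f i)"
  define j where "j = (LEAST j. j < Suc m \<and> \<not> int p ^ (Suc m - j) dvd coeff g j)"
  have i: "i < Suc n" "\<not> int p ^ (Suc n - i) dvd coeff f i"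
    using f(2) LeastI_ex[of "\<lambda>i. i < Suc n \<and> \<not> int p ^ (Suc n - i) dvd coeff f i"]
    unfolding wcond_def i_def by auto
  have j: "j < Suc m" "\<not> int p ^ (Suc m - j) dvd coeff g j"
    using g(2) LeastI_ex[of "\<lambda>j. j < Suc m \<and> \<not> int p ^ (Suc m - j) dvd coeff g j"]
    unfolding wcond_def j_def by auto
  have fi: "int p ^ (Suc n - k) dvd coeff f k" if "k < i" for k
    using not_less_Least[of k "\<lambda>i. i < Suc n \<and> \<not> int p ^ (Suc n - i) dvd coeff f i"] that i(1)
    unfolding i_def by auto
  have gj: "int p ^ (Suc m - k) dvd coeff g k" if "k < j" for k
    using not_less_Least[of k "\<lambda>j. j < Suc m \<and> \<not> int p ^ (Suc m - j) dvd coeff g j"] that j(1)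
    unfolding j_def by auto
  let ?N = "Suc (n + m) - (i + j)"
  have N: "?N = Suc ((n - i) + (m - j))" using i(1) j(1) by simp
  show "\<not> wcond p (Suc (n + m)) (f * g)"
  proof
    assume "wcond p (Suc (n + m)) (f * g)"
    then have "int p ^ ?N dvd coeff (f * g) (i + j)"
      unfolding wcond_def using i(1) j(1) by auto
    also have "coeff (f * g) (i + j) = coeff f i * coeff g j
        + (\<Sum>k\<in>{..i + j} - {i}. coeff f k * coeff g (i + j - k))"
      unfolding coeff_mult by (subst sum.remove[of _ i]) auto
    finally have d: "int p ^ ?N dvd \<dots>" .
    have "int p ^ ?N dvd (\<Sum>k\<in>{..i + j} - {i}. coeff f k * coeff g (i + j - k))"
    proof (rule dvd_sum)
      fix k assume k: "k \<in> {..i + j} - {i}"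
      show "int p ^ ?N dvd coeff f k * coeff g (i + j - k)"
      proof (cases "k < i")
        case True
        have "?N \<le> (Suc n - k) + (m - (i + j - k))" using True i(1) j(1) by linarith
        then show ?thesis
          using mult_dvd_mono[OF fi[OF True] gd, of "i + j - k"]
          by (metis power_add power_le_dvd)
      next
        case False
        with k have lt: "i + j - k < j" by auto
        have "?N \<le> (n - k) + (Suc m - (i + j - k))" using False k i(1) j(1) by auto
        then show ?thesis
          using mult_dvd_mono[OF fd gj[OF lt], of k]
          by (metis power_add power_le_dvd)
      qed
    qed
    with d have d: "int p ^ ?N dvd coeff f i * coeff g j"
      by (metis dvd_add_left_iff)
    obtain u where u: "coeff f i = int p ^ (n - i) * u" using fd by (auto elim: dvdE)
    obtain w where w: "coeff g j = int p ^ (m - j) * w" using gd by (auto elim: dvdE)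
    have nu: "\<not> int p dvd u"
    proof
      assume "int p dvd u"
      then have "int p ^ (n - i) * int p dvd coeff f i" unfolding u by simp
      then show False using i by (metis Suc_diff_le less_Suc_eq_le power_Suc2)
    qed
    have nw: "\<not> int p dvd w"
    proof
      assume "int p dvd w"
      then have "int p ^ (m - j) * int p dvd coeff g j" unfolding w by simp
      then show False using j by (metis Suc_diff_le less_Suc_eq_le power_Suc2)
    qed
    have "int p ^ ((n - i) + (m - j)) * int p dvd int p ^ ((n - i) + (m - j)) * (u * w)"
      using d unfolding N u w by (simp add: power_add mult_ac)
    then have "int p dvd u * w" using p_gt_1 by simp
    then show False using nu nw P by (simp add: prime_dvd_mult_iff)
  qed
qed

lemma ultra_abs_m_abs: "ultra_abs (m_abs p)"
proof
  fix x y :: "int poly"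
  show "0 \<le> m_abs p x" by (cases x rule: m_abs_cases) auto
  show "m_abs p x = 0 \<longleftrightarrow> x = 0"
    using p_gt_1 by (cases x rule: m_abs_cases) auto
  show "m_abs p (x * y) = m_abs p x * m_abs p y"
  proof (cases x rule: m_abs_cases)
    case (2 n)
    note n = this
    show ?thesis
    proof (cases y rule: m_abs_cases)
      case (2 m)
      have "x * y \<in> m_pow p (n + m)" "x * y \<notin> m_pow p (Suc (n + m))"
        using n 2 wcond_mult[of n "shift1 x" m "shift1 y"]
        by (simp_all add: m_pow_iff pcompose_mult)
      then have "m_abs p (x * y) = 1 / real p ^ (n + m)" by (rule m_abs_eqI)
      with n 2 show ?thesis by (simp add: power_add)
    qed simp
  qed simp
  show "m_abs p (x + y) \<le> max (m_abs p x) (m_abs p y)"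
  proof (cases x rule: m_abs_cases)
    case (2 n)
    note n = this
    show ?thesis
    proof (cases y rule: m_abs_cases)
      case (2 m)
      let ?k = "min n m"
      have "x + y \<in> m_pow p ?k"
        using n(2) 2(2) m_pow_antimono[of ?k n p] m_pow_antimono[of ?k m p]
        by (intro m_pow_add) auto
      then have "m_abs p (x + y) \<le> 1 / real p ^ ?k" by (simp only: m_abs_le_iff)
      also have "\<dots> \<le> max (m_abs p x) (m_abs p y)" using n 2 by (simp add: min_def)
      finally show ?thesis .
    qed simp
  qed simp
qed

end


section \<open>The localization of Z[q] at m and its completion\<close>

text \<open>\<open>Q(q)\<close> is the fraction field of \<open>Z[q]\<close>, i.e. the type \<open>int poly fract\<close>.\<close>

definition q_abs :: "nat \<Rightarrow> int poly fract \<Rightarrow> real" where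
  "q_abs p = fract_abs (m_abs p)"

definition m_loc :: "nat \<Rightarrow> int poly fract set" where
  "m_loc p = {Fract a b | a b. b \<notin> m_ideal p}"

definition m_cauchy :: "nat \<Rightarrow> (nat \<Rightarrow> int poly fract) \<Rightarrow> bool" where
  "m_cauchy p X \<longleftrightarrow> (\<forall>n. X n \<in> m_loc p) \<and>
     (\<forall>e>0. \<exists>N. \<forall>i\<ge>N. \<forall>j\<ge>N. q_abs p (X i - X j) < e)"

definition m_rel :: "nat \<Rightarrow> (nat \<Rightarrow> int poly fract) \<Rightarrow> (nat \<Rightarrow> int poly fract) \<Rightarrow> bool" where
  "m_rel p X Y \<longleftrightarrow> m_cauchy p X \<and> m_cauchy p Y \<and> (\<lambda>n. q_abs p (X n - Y n)) \<longlonglongrightarrow> 0"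

context
  fixes p :: nat
  assumes p: "prime p"
begin

interpretation q: ultra_abs "q_abs p"
  unfolding q_abs_def by (rule ultra_abs_fract_abs[OF ultra_abs_m_abs[OF p]])

interpretation m: ultra_abs "m_abs p"
  by (rule ultra_abs_m_abs[OF p])

lemma m_abs_le_1: "m_abs p x \<le> 1"
  using m_abs_le_iff[OF p, of x 0] by simp

lemma m_ideal_iff_poly: "x \<in> m_ideal p \<longleftrightarrow> int p dvd poly x 1"
  unfolding m_pow_1[symmetric] m_pow_iff wcond_def
  by (simp add: poly_0_coeff_0[symmetric] poly_pcompose)

lemma m_abs_eq_1: "x \<notin> m_ideal p \<Longrightarrow> m_abs p x = 1"
  using m_abs_eqI[OF p, of x 0] by (simp add: m_pow_1)

lemma not_m_ideal_nz: "x \<notin> m_ideal p \<Longrightarrow> x \<noteq> 0"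
  by (auto simp: m_ideal_iff_poly)

lemma not_m_ideal_mult: "x \<notin> m_ideal p \<Longrightarrow> y \<notin> m_ideal p \<Longrightarrow> x * y \<notin> m_ideal p"
  using p by (simp add: m_ideal_iff_poly prime_dvd_mult_iff)

lemma not_m_ideal_1: "1 \<notin> m_ideal p"
  using p_gt_1[OF p] by (simp add: m_ideal_iff_poly)

lemma q_abs_Fract: "b \<noteq> 0 \<Longrightarrow> q_abs p (Fract a b) = m_abs p a / m_abs p b"
  unfolding q_abs_def by (rule fract_abs_Fract[OF ultra_abs_m_abs[OF p]])

lemma m_locE:
  assumes "x \<in> m_loc p"
  obtains a b where "x = Fract a b" "b \<notin> m_ideal p" "b \<noteq> 0"
  using assms not_m_ideal_nz unfolding m_loc_def by blast

lemma m_locI: "b \<notin> m_ideal p \<Longrightarrow> Fract a b \<in> m_loc p"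
  unfolding m_loc_def by blast

lemma q_abs_loc_Fract: "b \<notin> m_ideal p \<Longrightarrow> q_abs p (Fract a b) = m_abs p a"
  by (simp add: q_abs_Fract not_m_ideal_nz m_abs_eq_1)

lemma q_abs_loc_le_1: "x \<in> m_loc p \<Longrightarrow> q_abs p x \<le> 1"
  by (elim m_locE) (simp add: q_abs_loc_Fract m_abs_le_1)

lemma m_loc_0: "0 \<in> m_loc p" and m_loc_1: "1 \<in> m_loc p"
  using m_locI[OF not_m_ideal_1] by (simp_all add: fract_expand)

lemma m_loc_add: "x \<in> m_loc p \<Longrightarrow> y \<in> m_loc p \<Longrightarrow> x + y \<in> m_loc p"
  by (elim m_locE) (simp add: m_locI not_m_ideal_mult)

lemma m_loc_mult: "x \<in> m_loc p \<Longrightarrow> y \<in> m_loc p \<Longrightarrow> x * y \<in> m_loc p"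
  by (elim m_locE) (simp add: m_locI not_m_ideal_mult)

lemma m_loc_minus: "x \<in> m_loc p \<Longrightarrow> - x \<in> m_loc p"
  by (elim m_locE) (simp add: m_locI)

lemma m_loc_diff: "x \<in> m_loc p \<Longrightarrow> y \<in> m_loc p \<Longrightarrow> x - y \<in> m_loc p"
  using m_loc_add[of x "- y"] m_loc_minus[of y] by simp

lemma m_cauchy_const: "x \<in> m_loc p \<Longrightarrow> m_cauchy p (\<lambda>_. x)"
  by (simp add: m_cauchy_def)

lemma m_cauchy_add:
  assumes "m_cauchy p X" "m_cauchy p Y"
  shows "m_cauchy p (\<lambda>n. X n + Y n)"
  unfolding m_cauchy_def
proof (intro conjI allI impI)
  fix n show "X n + Y n \<in> m_loc p" using assms by (simp add: m_cauchy_def m_loc_add)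
next
  fix e :: real assume "e > 0"
  then obtain N M where N: "\<forall>i\<ge>N. \<forall>j\<ge>N. q_abs p (X i - X j) < e"
    and M: "\<forall>i\<ge>M. \<forall>j\<ge>M. q_abs p (Y i - Y j) < e"
    using assms unfolding m_cauchy_def by meson
  show "\<exists>N. \<forall>i\<ge>N. \<forall>j\<ge>N. q_abs p (X i + Y i - (X j + Y j)) < e"
  proof (intro exI[of _ "max N M"] allI impI)
    fix i j assume "max N M \<le> i" "max N M \<le> j"
    then have "q_abs p (X i - X j) < e" "q_abs p (Y i - Y j) < e" using N M by auto
    moreover have "X i + Y i - (X j + Y j) = (X i - X j) + (Y i - Y j)" by simp
    ultimately show "q_abs p (X i + Y i - (X j + Y j)) < e"
      using q.add_le[of "X i - X j" "Y i - Y j"] by (simp only:)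
  qed
qed

lemma m_cauchy_minus: "m_cauchy p X \<Longrightarrow> m_cauchy p (\<lambda>n. - X n)"
  unfolding m_cauchy_def by (simp add: m_loc_minus) (metis q.diff_commute)

lemma q_abs_mult_diff_le:
  assumes "x \<in> m_loc p" "y' \<in> m_loc p"
  shows "q_abs p (x * y - x' * y') \<le> max (q_abs p (x - x')) (q_abs p (y - y'))"
proof -
  have "x * y - x' * y' = x * (y - y') + (x - x') * y'" by (simp add: algebra_simps)
  then have "q_abs p (x * y - x' * y') \<le> max (q_abs p x * q_abs p (y - y')) (q_abs p (x - x') * q_abs p y')"
    using q.add_le[of "x * (y - y')" "(x - x') * y'"] by (simp add: q.mult)
  moreover have "q_abs p x * q_abs p (y - y') \<le> q_abs p (y - y')"
    by (rule mult_left_le_one_le) (use assms q_abs_loc_le_1 q.nonneg in auto)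
  moreover have "q_abs p (x - x') * q_abs p y' \<le> q_abs p (x - x')"
    by (rule mult_right_le_one_le) (use assms q_abs_loc_le_1 q.nonneg in auto)
  ultimately show ?thesis by linarith
qed

lemma m_cauchy_mult:
  assumes "m_cauchy p X" "m_cauchy p Y"
  shows "m_cauchy p (\<lambda>n. X n * Y n)"
  unfolding m_cauchy_def
proof (intro conjI allI impI)
  fix n show "X n * Y n \<in> m_loc p" using assms by (simp add: m_cauchy_def m_loc_mult)
next
  fix e :: real assume "e > 0"
  then obtain N M where N: "\<forall>i\<ge>N. \<forall>j\<ge>N. q_abs p (X i - X j) < e"
    and M: "\<forall>i\<ge>M. \<forall>j\<ge>M. q_abs p (Y i - Y j) < e"
    using assms unfolding m_cauchy_def by meson
  show "\<exists>N. \<forall>i\<ge>N. \<forall>j\<ge>N. q_abs p (X i * Y i - X j * Y j) < e"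
  proof (intro exI[of _ "max N M"] allI impI)
    fix i j assume "max N M \<le> i" "max N M \<le> j"
    then have "q_abs p (X i - X j) < e" "q_abs p (Y i - Y j) < e" using N M by auto
    then show "q_abs p (X i * Y i - X j * Y j) < e"
      using q_abs_mult_diff_le[of "X i" "Y j" "Y i" "X j"] assms by (simp add: m_cauchy_def)
  qed
qed

lemma m_rel_refl: "m_rel p X X \<longleftrightarrow> m_cauchy p X"
  by (simp add: m_rel_def)

lemma q_abs_tendsto_0_le:
  assumes "\<And>n. q_abs p (Z n) \<le> max (f n) (g n)" "f \<longlonglongrightarrow> 0" "g \<longlonglongrightarrow> 0"
  shows "(\<lambda>n. q_abs p (Z n)) \<longlonglongrightarrow> 0"
proof (rule tendsto_sandwich[of "\<lambda>_. 0"])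
  show "(\<lambda>n. max (f n) (g n)) \<longlonglongrightarrow> 0" using tendsto_max[OF assms(2,3)] by simp
qed (use assms(1) q.nonneg in auto)

lemma part_equivp_m_rel: "part_equivp (m_rel p)"
proof (rule part_equivpI)
  show "\<exists>x. m_rel p x x" using m_cauchy_const[OF m_loc_0] m_rel_refl by blast
  show "symp (m_rel p)"
    by (auto simp: symp_def m_rel_def) (metis (no_types, lifting) ext q.diff_commute)
  show "transp (m_rel p)"
  proof (rule transpI)
    fix X Y Z assume "m_rel p X Y" "m_rel p Y Z"
    then show "m_rel p X Z"
      unfolding m_rel_def using q_abs_tendsto_0_le[OF q.diff_triangle[of "X _" "Z _" "Y _"]] by auto
  qed
qed

lemma m_rel_add:
  assumes "m_rel p X X'" "m_rel p Y Y'"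
  shows "m_rel p (\<lambda>n. X n + Y n) (\<lambda>n. X' n + Y' n)"
proof -
  have "q_abs p (X n + Y n - (X' n + Y' n)) \<le> max (q_abs p (X n - X' n)) (q_abs p (Y n - Y' n))" for n
    using q.add_le[of "X n - X' n" "Y n - Y' n"] by (simp add: algebra_simps)
  from q_abs_tendsto_0_le[OF this] show ?thesis
    using assms by (simp add: m_rel_def m_cauchy_add)
qed

lemma m_rel_minus:
  assumes "m_rel p X X'"
  shows "m_rel p (\<lambda>n. - X n) (\<lambda>n. - X' n)"
proof -
  have "q_abs p (- X n - (- X' n)) = q_abs p (X n - X' n)" for n
    using q.diff_commute[of "X n" "X' n"] by simp
  then show ?thesis using assms unfolding m_rel_def by (simp add: m_cauchy_minus)
qed

lemma m_rel_mult:
  assumes "m_rel p X X'" "m_rel p Y Y'"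
  shows "m_rel p (\<lambda>n. X n * Y n) (\<lambda>n. X' n * Y' n)"
proof -
  have "q_abs p (X n * Y n - X' n * Y' n) \<le> max (q_abs p (X n - X' n)) (q_abs p (Y n - Y' n))" for n
    by (rule q_abs_mult_diff_le) (use assms in \<open>auto simp: m_rel_def m_cauchy_def\<close>)
  from q_abs_tendsto_0_le[OF this] show ?thesis
    using assms by (simp add: m_rel_def m_cauchy_mult)
qed

lemma m_cauchy_q_abs_convergent:
  assumes "m_cauchy p X"
  shows "convergent (\<lambda>n. q_abs p (X n))"
proof (rule Cauchy_convergent, rule metric_CauchyI)
  fix e :: real assume "e > 0"
  then obtain N where "\<forall>i\<ge>N. \<forall>j\<ge>N. q_abs p (X i - X j) < e"
    using assms unfolding m_cauchy_def by meson
  then have "\<forall>i\<ge>N. \<forall>j\<ge>N. dist (q_abs p (X i)) (q_abs p (X j)) < e"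
    unfolding dist_real_def using q.abs_diff_le by (meson le_less_trans)
  then show "\<exists>M. \<forall>m\<ge>M. \<forall>n\<ge>M. dist (q_abs p (X m)) (q_abs p (X n)) < e" by blast
qed

lemma m_cauchy_q_abs_lim: "m_cauchy p X \<Longrightarrow> (\<lambda>n. q_abs p (X n)) \<longlonglongrightarrow> lim (\<lambda>n. q_abs p (X n))"
  using m_cauchy_q_abs_convergent convergent_LIMSEQ_iff by blast

lemma m_rel_lim_eq:
  assumes "m_rel p X Y"
  shows "lim (\<lambda>n. q_abs p (X n)) = lim (\<lambda>n. q_abs p (Y n))"
proof -
  have "(\<lambda>n. q_abs p (X n) - q_abs p (Y n)) \<longlonglongrightarrow> lim (\<lambda>n. q_abs p (X n)) - lim (\<lambda>n. q_abs p (Y n))"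
    using assms unfolding m_rel_def by (intro tendsto_diff m_cauchy_q_abs_lim) auto
  moreover have "(\<lambda>n. q_abs p (X n) - q_abs p (Y n)) \<longlonglongrightarrow> 0"
  proof (rule tendsto_rabs_zero_cancel, rule tendsto_sandwich[of "\<lambda>_. 0"])
    show "(\<lambda>n. q_abs p (X n - Y n)) \<longlonglongrightarrow> 0" using assms by (simp add: m_rel_def)
  qed (use q.abs_diff_le in auto)
  ultimately show ?thesis using LIMSEQ_unique by fastforce
qed

lemma m_rel_zero_iff:
  assumes "m_cauchy p X"
  shows "m_rel p X (\<lambda>_. 0) \<longleftrightarrow> lim (\<lambda>n. q_abs p (X n)) = 0"
  using m_cauchy_q_abs_lim[OF assms] assms m_cauchy_const[OF m_loc_0] limI
  by (auto simp: m_rel_def)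

lemma m_cauchy_lim_mult:
  assumes "m_cauchy p X" "m_cauchy p Y"
  shows "lim (\<lambda>n. q_abs p (X n * Y n)) = lim (\<lambda>n. q_abs p (X n)) * lim (\<lambda>n. q_abs p (Y n))"
  unfolding q.mult by (intro limI tendsto_mult m_cauchy_q_abs_lim assms)

lemma m_cauchy_lim_add:
  assumes "m_cauchy p X" "m_cauchy p Y"
  shows "lim (\<lambda>n. q_abs p (X n + Y n)) \<le> max (lim (\<lambda>n. q_abs p (X n))) (lim (\<lambda>n. q_abs p (Y n)))"
  by (rule LIMSEQ_le[OF m_cauchy_q_abs_lim[OF m_cauchy_add[OF assms]]
        tendsto_max[OF m_cauchy_q_abs_lim[OF assms(1)] m_cauchy_q_abs_lim[OF assms(2)]]])
    (use q.add_le in blast)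

lemma m_cauchy_lim_bounds:
  assumes "m_cauchy p X"
  shows "0 \<le> lim (\<lambda>n. q_abs p (X n))" "lim (\<lambda>n. q_abs p (X n)) \<le> 1"
proof -
  show "0 \<le> lim (\<lambda>n. q_abs p (X n))"
    by (rule LIMSEQ_le_const[OF m_cauchy_q_abs_lim[OF assms]]) (use q.nonneg in auto)
  show "lim (\<lambda>n. q_abs p (X n)) \<le> 1"
    by (rule LIMSEQ_le_const2[OF m_cauchy_q_abs_lim[OF assms]])
      (use q_abs_loc_le_1 assms in \<open>auto simp: m_cauchy_def\<close>)
qed

end

lemma prime_CARD: "prime CARD('p::prime_card)"
  by (rule prime_card)

text \<open>The completion consists of the classes of Cauchy sequences in the localization modulo null
  sequences. (The type is set up by hand, since the \<open>quotient_type\<close> command does not accept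
  a relation depending on a type parameter that is absent from the raw type.)\<close>

typedef (overloaded) ('p::prime_card) zqp =
    "{{Y. m_rel CARD('p) X Y} | X. m_cauchy CARD('p) X}"
  using m_cauchy_const[OF prime_CARD m_loc_0[OF prime_CARD]] by blast

definition zqp_class :: "(nat \<Rightarrow> int poly fract) \<Rightarrow> 'p::prime_card zqp" where
  "zqp_class X = Abs_zqp {Y. m_rel CARD('p) X Y}"

definition zqp_repr :: "'p::prime_card zqp \<Rightarrow> nat \<Rightarrow> int poly fract" where
  "zqp_repr x = (SOME X. X \<in> Rep_zqp x)"

definition cr_zqp :: "(nat \<Rightarrow> int poly fract) \<Rightarrow> 'p::prime_card zqp \<Rightarrow> bool" where
  "cr_zqp X x \<longleftrightarrow> m_rel CARD('p) X X \<and> zqp_class X = x"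

lemma Quotient_zqp:
  "Quotient (m_rel CARD('p)) zqp_class zqp_repr (cr_zqp :: _ \<Rightarrow> 'p::prime_card zqp \<Rightarrow> bool)"
proof -
  have pr: "prime CARD('p)" by (rule prime_CARD)
  note eq = part_equivp_m_rel[OF pr]
  have sym: "m_rel CARD('p) Y X" if "m_rel CARD('p) X Y" for X Y
    by (rule part_equivp_symp[OF eq]) (rule that)
  have trans: "m_rel CARD('p) X Z" if "m_rel CARD('p) X Y" "m_rel CARD('p) Y Z" for X Y Z
    by (rule part_equivp_transp[OF eq]) (rule that)+
  have cau: "m_cauchy CARD('p) X \<longleftrightarrow> m_rel CARD('p) X X" for X
    using m_rel_refl[OF pr] by blast
  have Rep_class: "Rep_zqp (zqp_class X :: 'p zqp) = {Y. m_rel CARD('p) X Y}" if "m_rel CARD('p) X X" for X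
    unfolding zqp_class_def by (rule Abs_zqp_inverse) (use that cau in blast)
  have repr: "zqp_repr x \<in> Rep_zqp x \<and> Rep_zqp x = {Y. m_rel CARD('p) (zqp_repr x) Y}
      \<and> m_rel CARD('p) (zqp_repr x) (zqp_repr x)" for x :: "'p zqp"
  proof -
    obtain X where X: "m_rel CARD('p) X X" "Rep_zqp x = {Y. m_rel CARD('p) X Y}"
      using Rep_zqp[of x] cau by blast
    then have "X \<in> Rep_zqp x" by simp
    then have in_Rep: "zqp_repr x \<in> Rep_zqp x" unfolding zqp_repr_def by (metis someI_ex)
    then have "m_rel CARD('p) X (zqp_repr x)" using X by simp
    with X in_Rep show ?thesis using sym trans by blast
  qed
  show ?thesis
    unfolding Quotient_def
  proof (intro conjI allI)
    fix x :: "'p zqp" and X Y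
    show "zqp_class (zqp_repr x) = x"
      using repr[of x] Rep_zqp_inverse[of x] by (simp add: zqp_class_def)
    show "m_rel CARD('p) (zqp_repr x) (zqp_repr x)" using repr by blast
    show "m_rel CARD('p) X Y \<longleftrightarrow>
        m_rel CARD('p) X X \<and> m_rel CARD('p) Y Y \<and> (zqp_class X :: 'p zqp) = zqp_class Y"
    proof (intro iffI)
      assume XY: "m_rel CARD('p) X Y"
      then have "{Z. m_rel CARD('p) X Z} = {Z. m_rel CARD('p) Y Z}" using sym trans by blast
      with XY show "m_rel CARD('p) X X \<and> m_rel CARD('p) Y Y \<and> (zqp_class X :: 'p zqp) = zqp_class Y"
        unfolding zqp_class_def using sym trans by metis
    next
      assume *: "m_rel CARD('p) X X \<and> m_rel CARD('p) Y Y \<and> (zqp_class X :: 'p zqp) = zqp_class Y"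
      then have "{Z. m_rel CARD('p) X Z} = {Z. m_rel CARD('p) Y Z}" using Rep_class by metis
      with * show "m_rel CARD('p) X Y" by blast
    qed
  qed (auto simp: cr_zqp_def fun_eq_iff)
qed

setup_lifting Quotient_zqp

instantiation zqp :: (prime_card) comm_ring_1
begin

lift_definition zero_zqp :: "'a zqp" is "\<lambda>_. 0"
  by (simp add: m_rel_refl[OF prime_CARD] m_cauchy_const[OF prime_CARD] m_loc_0[OF prime_CARD])

lift_definition one_zqp :: "'a zqp" is "\<lambda>_. 1"
  by (simp add: m_rel_refl[OF prime_CARD] m_cauchy_const[OF prime_CARD] m_loc_1[OF prime_CARD])

lift_definition plus_zqp :: "'a zqp \<Rightarrow> 'a zqp \<Rightarrow> 'a zqp" is "\<lambda>X Y n. X n + Y n"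
  by (rule m_rel_add[OF prime_CARD])

lift_definition uminus_zqp :: "'a zqp \<Rightarrow> 'a zqp" is "\<lambda>X n. - X n"
  by (rule m_rel_minus[OF prime_CARD])

lift_definition minus_zqp :: "'a zqp \<Rightarrow> 'a zqp \<Rightarrow> 'a zqp" is "\<lambda>X Y n. X n - Y n"
  using m_rel_add[OF prime_CARD _ m_rel_minus[OF prime_CARD]] by fastforce

lift_definition times_zqp :: "'a zqp \<Rightarrow> 'a zqp \<Rightarrow> 'a zqp" is "\<lambda>X Y n. X n * Y n"
  by (rule m_rel_mult[OF prime_CARD])

lemma not_m_rel_0_1: "\<not> m_rel CARD('a) (\<lambda>_. 0) (\<lambda>_. 1)"
proof -
  interpret q: ultra_abs "q_abs CARD('a)"
    unfolding q_abs_def by (rule ultra_abs_fract_abs[OF ultra_abs_m_abs[OF prime_CARD]])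
  show ?thesis by (simp add: m_rel_def LIMSEQ_const_iff)
qed

instance
proof
  fix a b c :: "'a zqp"
  show "a * b * c = a * (b * c)"
    by transfer (simp add: m_rel_refl[OF prime_CARD] m_cauchy_mult[OF prime_CARD] mult.assoc)
  show "a * b = b * a"
    by transfer (simp add: m_rel_refl[OF prime_CARD] m_cauchy_mult[OF prime_CARD] mult.commute)
  show "1 * a = a"
    by transfer (simp add: m_rel_refl[OF prime_CARD])
  show "a + b + c = a + (b + c)"
    by transfer (simp add: m_rel_refl[OF prime_CARD] m_cauchy_add[OF prime_CARD] add.assoc)
  show "a + b = b + a"
    by transfer (simp add: m_rel_refl[OF prime_CARD] m_cauchy_add[OF prime_CARD] add.commute)
  show "0 + a = a"
    by transfer (simp add: m_rel_refl[OF prime_CARD])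
  show "- a + a = 0"
    by transfer
      (simp add: m_rel_refl[OF prime_CARD] m_cauchy_const[OF prime_CARD] m_loc_0[OF prime_CARD])
  show "a - b = a + - b"
    by transfer (simp add: m_rel_refl[OF prime_CARD] m_cauchy_add[OF prime_CARD]
        m_cauchy_minus[OF prime_CARD] diff_conv_add_uminus del: add_uminus_conv_diff)
  show "(a + b) * c = a * c + b * c"
    by transfer (simp add: m_rel_refl[OF prime_CARD] m_cauchy_add[OF prime_CARD]
        m_cauchy_mult[OF prime_CARD] distrib_right)
  show "(0 :: 'a zqp) \<noteq> 1"
    by transfer (rule not_m_rel_0_1)
qed

end

text \<open>The absolute value of the completion.\<close>

lift_definition zqp_abs :: "'p::prime_card zqp \<Rightarrow> real" is "\<lambda>X. lim (\<lambda>n. q_abs CARD('p) (X n))"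
  by (rule m_rel_lim_eq[OF prime_CARD])

lemma ultra_abs_zqp_abs: "ultra_abs (zqp_abs :: 'p::prime_card zqp \<Rightarrow> real)"
proof
  fix x y :: "'p zqp"
  show "0 \<le> zqp_abs x"
    by transfer (simp add: m_rel_refl[OF prime_CARD] m_cauchy_lim_bounds[OF prime_CARD])
  show "zqp_abs x = 0 \<longleftrightarrow> x = 0"
    by transfer (simp add: m_rel_refl[OF prime_CARD] m_rel_zero_iff[OF prime_CARD])
  show "zqp_abs (x * y) = zqp_abs x * zqp_abs y"
    by transfer (simp add: m_rel_refl[OF prime_CARD] m_cauchy_lim_mult[OF prime_CARD])
  show "zqp_abs (x + y) \<le> max (zqp_abs x) (zqp_abs y)"
    by transfer (use m_rel_refl[OF prime_CARD] m_cauchy_lim_add[OF prime_CARD] in blast)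
qed

instantiation zqp :: (prime_card) metric_space
begin

definition dist_zqp :: "'a zqp \<Rightarrow> 'a zqp \<Rightarrow> real" where
  "dist_zqp x y = zqp_abs (x - y)"

definition uniformity_zqp :: "('a zqp \<times> 'a zqp) filter" where
  "uniformity_zqp = (INF e\<in>{0<..}. principal {(x, y). dist x y < e})"

definition open_zqp :: "'a zqp set \<Rightarrow> bool" where
  "open_zqp U = (\<forall>x\<in>U. \<forall>\<^sub>F (x', y) in uniformity. x' = x \<longrightarrow> y \<in> U)"

instance
proof
  interpret ultra_abs "zqp_abs :: 'a zqp \<Rightarrow> real" by (rule ultra_abs_zqp_abs)
  fix x y z :: "'a zqp" and U :: "'a zqp set"
  show "uniformity = (INF e\<in>{0<..}. principal {(x :: 'a zqp, y). dist x y < e})"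
    by (rule uniformity_zqp_def)
  show "open U \<longleftrightarrow> (\<forall>x\<in>U. \<forall>\<^sub>F (x', y) in uniformity. x' = x \<longrightarrow> y \<in> U)"
    by (rule open_zqp_def)
  show "dist x y = 0 \<longleftrightarrow> x = y"
    by (simp add: dist_zqp_def zero_iff)
  show "dist x y \<le> dist x z + dist y z"
    using diff_triangle[of x y z] nonneg[of "x - z"] nonneg[of "z - y"] diff_commute[of y z]
    by (simp add: dist_zqp_def)
qed

end

interpretation zqp: ultra_abs "zqp_abs :: 'p::prime_card zqp \<Rightarrow> real"
  by (rule ultra_abs_zqp_abs)

lemma zqp_abs_le_1: "zqp_abs (x :: 'p::prime_card zqp) \<le> 1"
  by transfer (simp add: m_rel_refl[OF prime_CARD] m_cauchy_lim_bounds[OF prime_CARD])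

instance zqp :: (prime_card) idom
proof
  fix x y :: "'a zqp"
  assume "x \<noteq> 0" "y \<noteq> 0"
  then show "x * y \<noteq> 0"
    using zqp.mult[of x y] zqp.zero_iff[of x] zqp.zero_iff[of y]
      zqp.zero_iff[of "x * y"] by auto
qed

text \<open>The canonical embedding of the localization (with junk value 0 outside of it).\<close>

lift_definition zq_of :: "int poly fract \<Rightarrow> 'p::prime_card zqp"
  is "\<lambda>x _. if x \<in> m_loc CARD('p) then x else 0"
  by (simp add: m_rel_refl[OF prime_CARD] m_cauchy_const[OF prime_CARD] m_loc_0[OF prime_CARD])

lemma zq_of_0: "zq_of 0 = (0 :: 'p::prime_card zqp)"
  by transfer (simp add: m_rel_refl[OF prime_CARD] m_cauchy_const[OF prime_CARD] m_loc_0[OF prime_CARD])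

lemma zq_of_1: "zq_of 1 = (1 :: 'p::prime_card zqp)"
  by transfer (simp add: m_rel_refl[OF prime_CARD] m_cauchy_const[OF prime_CARD] m_loc_1[OF prime_CARD])

lemma zq_of_add:
  assumes "x \<in> m_loc CARD('p)" "y \<in> m_loc CARD('p)"
  shows "zq_of (x + y) = (zq_of x + zq_of y :: 'p::prime_card zqp)"
  using assms
  by transfer (simp add: m_rel_refl[OF prime_CARD] m_cauchy_const[OF prime_CARD] m_loc_add[OF prime_CARD])

lemma zq_of_mult:
  assumes "x \<in> m_loc CARD('p)" "y \<in> m_loc CARD('p)"
  shows "zq_of (x * y) = (zq_of x * zq_of y :: 'p::prime_card zqp)"
  using assms
  by transfer (simp add: m_rel_refl[OF prime_CARD] m_cauchy_const[OF prime_CARD] m_loc_mult[OF prime_CARD])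

lemma zqp_abs_zq_of:
  assumes "x \<in> m_loc CARD('p)"
  shows "zqp_abs (zq_of x :: 'p::prime_card zqp) = q_abs CARD('p) x"
  using assms by transfer simp

lemma zq_of_tendsto_class:
  assumes X: "m_cauchy CARD('p) X"
  shows "(\<lambda>n. zq_of (X n)) \<longlonglongrightarrow> (zqp_class X :: 'p::prime_card zqp)"
proof -
  have pr: "prime CARD('p)" by (rule prime_CARD)
  define x where "x = (zqp_class X :: 'p zqp)"
  have loc: "X n \<in> m_loc CARD('p)" for n using X by (simp add: m_cauchy_def)
  have abs_eq: "dist (zq_of (X n)) x = lim (\<lambda>k. q_abs CARD('p) (X n - X k))" for n
  proof -
    have "zq_of (X n) = (zqp_class (\<lambda>_. X n) :: 'p zqp)"
      using loc[of n] by (simp add: zq_of.abs_eq)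
    then have "zq_of (X n) - x = zqp_class (\<lambda>k. X n - X k)"
      unfolding x_def using m_rel_refl[OF pr] X
        m_cauchy_const[OF pr loc] by (simp add: minus_zqp.abs_eq)
    moreover have "m_rel CARD('p) (\<lambda>k. X n - X k) (\<lambda>k. X n - X k)"
      using m_cauchy_add[OF pr m_cauchy_const[OF pr loc[of n]]
          m_cauchy_minus[OF pr X]]
        m_rel_refl[OF pr] by simp
    ultimately show ?thesis by (simp add: dist_zqp_def zqp_abs.abs_eq)
  qed
  show "(\<lambda>n. zq_of (X n)) \<longlonglongrightarrow> (zqp_class X :: 'p zqp)"
    unfolding x_def[symmetric]
  proof (rule metric_LIMSEQ_I)
    fix e :: real assume e: "e > 0"
    then obtain N where N: "\<forall>i\<ge>N. \<forall>j\<ge>N. q_abs CARD('p) (X i - X j) < e / 2"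
      using X unfolding m_cauchy_def by (meson half_gt_zero)
    show "\<exists>N. \<forall>n\<ge>N. dist (zq_of (X n)) x < e"
    proof (intro exI[of _ N] allI impI)
      fix n assume n: "n \<ge> N"
      have c: "m_cauchy CARD('p) (\<lambda>k. X n - X k)"
        using m_cauchy_add[OF pr m_cauchy_const[OF pr loc[of n]]
            m_cauchy_minus[OF pr X]] by simp
      have "lim (\<lambda>k. q_abs CARD('p) (X n - X k)) \<le> e / 2"
        by (rule LIMSEQ_le_const2[OF m_cauchy_q_abs_lim[OF pr c]])
          (use N n in \<open>auto intro!: exI[of _ N] less_imp_le\<close>)
      then show "dist (zq_of (X n)) x < e" using e by (simp add: abs_eq)
    qed
  qed
qed

lemma zq_of_dense:
  fixes x :: "'p::prime_card zqp"
  obtains X where "\<And>n. X n \<in> m_loc CARD('p)" "(\<lambda>n. zq_of (X n)) \<longlonglongrightarrow> x"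
proof -
  have "prime CARD('p)" by (rule prime_CARD)
  then obtain X where X: "m_cauchy CARD('p) X" "x = zqp_class X"
    using Quotient_zqp m_rel_refl unfolding Quotient_def by metis
  show ?thesis
    by (rule that[of X]) (use X zq_of_tendsto_class[OF X(1)] in \<open>simp_all add: m_cauchy_def\<close>)
qed

instance zqp :: (prime_card) complete_space
proof
  fix x :: "nat \<Rightarrow> 'a zqp"
  assume C: "Cauchy x"
  have pr: "prime CARD('a)" by (rule prime_CARD)
  have "\<exists>y. y \<in> m_loc CARD('a) \<and> dist (zq_of y) (x n) < inverse (real (Suc n))" for n
  proof -
    obtain X where X: "\<And>k. X k \<in> m_loc CARD('a)" "(\<lambda>k. zq_of (X k)) \<longlonglongrightarrow> x n"
      using zq_of_dense[of "x n"] by blast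
    obtain k where "dist (zq_of (X k)) (x n) < inverse (real (Suc n))"
      using metric_LIMSEQ_D[OF X(2), of "inverse (real (Suc n))"] by auto
    with X(1) show ?thesis by blast
  qed
  then obtain y where y: "\<And>n. y n \<in> m_loc CARD('a)"
    "\<And>n. dist (zq_of (y n)) (x n) < inverse (real (Suc n))" by metis
  have y_lim: "(\<lambda>n. dist (zq_of (y n)) (x n)) \<longlonglongrightarrow> 0"
    by (rule tendsto_sandwich[OF _ _ tendsto_const LIMSEQ_inverse_real_of_nat])
      (use y(2) in \<open>auto intro!: always_eventually less_imp_le\<close>)
  have "Cauchy (\<lambda>n. zq_of (y n) :: 'a zqp)"
  proof (rule metric_CauchyI)
    fix e :: real assume e: "e > 0"
    obtain N where N: "\<And>n. n \<ge> N \<Longrightarrow> dist (zq_of (y n)) (x n) < e / 3"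
      using metric_LIMSEQ_D[OF y_lim, of "e / 3"] e by auto
    obtain M where M: "\<And>i j. i \<ge> M \<Longrightarrow> j \<ge> M \<Longrightarrow> dist (x i) (x j) < e / 3"
      using metric_CauchyD[OF C, of "e / 3"] e by auto
    show "\<exists>M. \<forall>i\<ge>M. \<forall>j\<ge>M. dist (zq_of (y i) :: 'a zqp) (zq_of (y j)) < e"
    proof (intro exI[of _ "max M N"] allI impI)
      fix i j assume "max M N \<le> i" "max M N \<le> j"
      then have "dist (zq_of (y i)) (x i) < e / 3" "dist (x i) (x j) < e / 3"
        "dist (zq_of (y j)) (x j) < e / 3" using M N by auto
      then show "dist (zq_of (y i) :: 'a zqp) (zq_of (y j)) < e"
        using dist_triangle[of "zq_of (y i)" "zq_of (y j)" "x i"]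
          dist_triangle[of "x i" "zq_of (y j)" "x j"] dist_commute[of "x j" "zq_of (y j)"] by linarith
    qed
  qed
  moreover have "dist (zq_of (y i) :: 'a zqp) (zq_of (y j)) = q_abs CARD('a) (y i - y j)" for i j
  proof -
    have "zq_of (y i) = (zq_of (y i - y j) + zq_of (y j) :: 'a zqp)"
      using zq_of_add[OF m_loc_diff[OF pr y(1) y(1)] y(1), of i j j] by simp
    then show ?thesis
      using zqp_abs_zq_of[OF m_loc_diff[OF pr y(1) y(1)], of i j] by (simp add: dist_zqp_def)
  qed
  ultimately have "m_cauchy CARD('a) y"
    using y(1) by (simp add: m_cauchy_def Cauchy_def)
  from zq_of_tendsto_class[OF this]
  have L: "(\<lambda>n. dist (zq_of (y n)) (zqp_class y :: 'a zqp)) \<longlonglongrightarrow> 0"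
    by (rule iffD1[OF tendsto_dist_iff])
  have "(\<lambda>n. dist (x n) (zqp_class y)) \<longlonglongrightarrow> 0"
  proof (rule tendsto_sandwich[OF _ _ tendsto_const])
    show "(\<lambda>n. dist (zq_of (y n)) (x n) + dist (zq_of (y n)) (zqp_class y :: 'a zqp)) \<longlonglongrightarrow> 0"
      using tendsto_add[OF y_lim L] by simp
  qed (use dist_triangle3 in \<open>auto intro!: always_eventually\<close>)
  then have "x \<longlonglongrightarrow> zqp_class y" by (rule iffD2[OF tendsto_dist_iff])
  then show "convergent x" by (rule convergentI)
qed


section \<open>The Frobenius endomorphism\<close>

definition q_subst :: "nat \<Rightarrow> int poly fract \<Rightarrow> int poly fract" where
  "q_subst p x = (THE y. \<exists>P Q. Q \<noteq> 0 \<and> x = Fract P Q \<and>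
     y = Fract (pcompose P (monom 1 p)) (pcompose Q (monom 1 p)))"

context
  fixes p :: nat
  assumes p: "prime p"
begin

interpretation q: ultra_abs "q_abs p"
  unfolding q_abs_def by (rule ultra_abs_fract_abs[OF ultra_abs_m_abs[OF p]])

lemma pcompose_one: "pcompose (1 :: int poly) r = 1"
  by (simp add: one_pCons pcompose_pCons)

lemma pcompose_monom_nz: "pcompose Q (monom 1 p) = 0 \<longleftrightarrow> Q = 0" for Q :: "int poly"
  using prime_gt_0_nat[OF p] by (auto simp: pcompose_eq_0_iff degree_monom_eq)

lemma q_subst_Fract:
  assumes "Q \<noteq> 0"
  shows "q_subst p (Fract P Q) = Fract (pcompose P (monom 1 p)) (pcompose Q (monom 1 p))"
  unfolding q_subst_def
proof (rule the_equality)
  fix y assume "\<exists>P' Q'. Q' \<noteq> 0 \<and> Fract P Q = Fract P' Q' \<and>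
     y = Fract (pcompose P' (monom 1 p)) (pcompose Q' (monom 1 p))"
  then obtain P' Q' where *: "Q' \<noteq> 0" "Fract P Q = Fract P' Q'"
    "y = Fract (pcompose P' (monom 1 p)) (pcompose Q' (monom 1 p))" by blast
  then have "P * Q' = P' * Q" using assms by (simp add: eq_fract)
  then have "pcompose P (monom 1 p) * pcompose Q' (monom 1 p)
      = pcompose P' (monom 1 p) * pcompose Q (monom 1 p)"
    by (metis pcompose_mult)
  then show "y = Fract (pcompose P (monom 1 p)) (pcompose Q (monom 1 p))"
    using * assms by (simp add: eq_fract pcompose_monom_nz)
qed (use assms in blast)

lemma q_subst_add: "q_subst p (x + y) = q_subst p x + q_subst p y"
  by (cases x, cases y) (simp add: q_subst_Fract pcompose_monom_nz pcompose_add pcompose_mult)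

lemma q_subst_mult: "q_subst p (x * y) = q_subst p x * q_subst p y"
  by (cases x, cases y) (simp add: q_subst_Fract pcompose_monom_nz pcompose_mult)

lemma q_subst_0: "q_subst p 0 = 0" and q_subst_1: "q_subst p 1 = 1"
  by (simp_all add: fract_expand q_subst_Fract pcompose_one eq_fract)

lemma q_subst_minus: "q_subst p (- x) = - q_subst p x"
  by (cases x) (simp add: q_subst_Fract pcompose_uminus)

lemma q_subst_diff: "q_subst p (x - y) = q_subst p x - q_subst p y"
  using q_subst_add[of x "- y"] by (simp add: q_subst_minus)

lemma not_m_ideal_pcompose:
  "Q \<notin> m_ideal p \<Longrightarrow> pcompose Q (monom 1 p) \<notin> m_ideal p"
  by (simp add: m_ideal_iff_poly[OF p] poly_pcompose poly_monom)

lemma m_pow_pcompose: "x \<in> m_pow p n \<Longrightarrow> pcompose x (monom 1 p) \<in> m_pow p n"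
proof (induction n arbitrary: x)
  case (Suc n)
  obtain a b where x: "x = of_nat p * a + (1 - qvar) * b"
    and "a \<in> m_pow p n" "b \<in> m_pow p n" using m_pow_SucE[OF Suc.prems] .
  then have ab: "pcompose a (monom 1 p) \<in> m_pow p n" "pcompose b (monom 1 p) \<in> m_pow p n"
    using Suc.IH by blast+
  have mono: "monom 1 p = qvar ^ p" by (simp add: monom_altdef)
  have "pcompose x (monom 1 p) = of_nat p * pcompose a (monom 1 p) + (1 - qvar ^ p) * pcompose b (monom 1 p)"
    unfolding x mono by (simp add: pcompose_add pcompose_mult pcompose_diff pcompose_pCons pcompose_one
        pcompose_smult of_nat_poly)
  also have "1 - qvar ^ p = (1 - qvar) * (\<Sum>i<p. qvar ^ i)"
    by (rule one_diff_power_eq)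
  finally have "pcompose x (monom 1 p) = of_nat p * pcompose a (monom 1 p)
      + (1 - qvar) * ((\<Sum>i<p. qvar ^ i) * pcompose b (monom 1 p))"
    by (simp only: mult.assoc)
  then show ?case using m_pow_SucI[OF ab(1) m_pow_mult[OF ab(2)]] by (simp only:)
qed simp

lemma q_subst_loc: "x \<in> m_loc p \<Longrightarrow> q_subst p x \<in> m_loc p"
  by (elim m_locE[OF p]) (simp add: q_subst_Fract m_locI[OF p] not_m_ideal_pcompose)

lemma q_abs_q_subst_le:
  assumes "x \<in> m_loc p"
  shows "q_abs p (q_subst p x) \<le> q_abs p x"
proof -
  obtain a b where x: "x = Fract a b" "b \<notin> m_ideal p" "b \<noteq> 0" using m_locE[OF p assms] .
  have "m_abs p (pcompose a (monom 1 p)) \<le> m_abs p a"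
  proof (cases a rule: m_abs_cases[OF p])
    case (2 n)
    then show ?thesis using m_pow_pcompose m_abs_le_iff[OF p] by metis
  qed simp
  then show ?thesis using x by (simp add: q_subst_Fract q_abs_loc_Fract[OF p] not_m_ideal_pcompose)
qed

lemma m_cauchy_q_subst:
  assumes "m_cauchy p X"
  shows "m_cauchy p (\<lambda>n. q_subst p (X n))"
  unfolding m_cauchy_def q_subst_diff[symmetric]
proof (intro conjI allI impI)
  fix n show "q_subst p (X n) \<in> m_loc p" using assms by (simp add: m_cauchy_def q_subst_loc)
next
  have le: "q_abs p (q_subst p (X i - X j)) \<le> q_abs p (X i - X j)" for i j
    using assms by (simp add: m_cauchy_def m_loc_diff[OF p] q_abs_q_subst_le)
  fix e :: real assume "e > 0"
  then obtain N where "\<forall>i\<ge>N. \<forall>j\<ge>N. q_abs p (X i - X j) < e"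
    using assms unfolding m_cauchy_def by meson
  then show "\<exists>N. \<forall>i\<ge>N. \<forall>j\<ge>N. q_abs p (q_subst p (X i - X j)) < e"
    using le le_less_trans by blast
qed

lemma m_rel_q_subst:
  assumes "m_rel p X Y"
  shows "m_rel p (\<lambda>n. q_subst p (X n)) (\<lambda>n. q_subst p (Y n))"
proof -
  have le: "q_abs p (q_subst p (X i - Y i)) \<le> q_abs p (X i - Y i)" for i
    using assms by (simp add: m_rel_def m_cauchy_def m_loc_diff[OF p] q_abs_q_subst_le)
  have "(\<lambda>n. q_abs p (q_subst p (X n - Y n))) \<longlonglongrightarrow> 0"
    by (rule tendsto_sandwich[of "\<lambda>_. 0"])
      (use le q.nonneg assms in \<open>auto simp: m_rel_def\<close>)
  then show ?thesis using assms by (simp add: m_rel_def m_cauchy_q_subst q_subst_diff)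
qed

lemma m_cauchy_lim_q_subst_le:
  assumes "m_cauchy p X"
  shows "lim (\<lambda>n. q_abs p (q_subst p (X n))) \<le> lim (\<lambda>n. q_abs p (X n))"
  by (rule LIMSEQ_le[OF m_cauchy_q_abs_lim[OF p m_cauchy_q_subst[OF assms]] m_cauchy_q_abs_lim[OF p assms]])
    (use assms in \<open>auto simp: m_cauchy_def q_abs_q_subst_le\<close>)

end

text \<open>The extension by continuity of \<open>P(q)/Q(q) \<mapsto> P(q^p)/Q(q^p)\<close>; that it is the unique continuous
  ring endomorphism with this property is shown below.\<close>

lift_definition Fq :: "'p::prime_card zqp \<Rightarrow> 'p zqp" is "\<lambda>X n. q_subst CARD('p) (X n)"
  by (rule m_rel_q_subst[OF prime_CARD])

lemma Fq_add: "Fq (x + y) = Fq x + Fq y"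
  by transfer (simp add: q_subst_add[OF prime_CARD] m_rel_refl[OF prime_CARD]
      m_cauchy_add[OF prime_CARD] m_cauchy_q_subst[OF prime_CARD])

lemma Fq_mult: "Fq (x * y) = Fq x * Fq y"
  by transfer (simp add: q_subst_mult[OF prime_CARD] m_rel_refl[OF prime_CARD]
      m_cauchy_mult[OF prime_CARD] m_cauchy_q_subst[OF prime_CARD])

lemma Fq_1: "Fq 1 = 1"
  by transfer (simp add: q_subst_1[OF prime_CARD] m_rel_refl[OF prime_CARD]
      m_cauchy_const[OF prime_CARD] m_loc_1[OF prime_CARD])

lemma Fq_minus: "Fq (- x) = - Fq x"
  by transfer (simp add: q_subst_minus[OF prime_CARD] m_rel_refl[OF prime_CARD]
      m_cauchy_minus[OF prime_CARD] m_cauchy_q_subst[OF prime_CARD])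

lemma Fq_zq_of:
  assumes "Q \<notin> m_ideal CARD('p)"
  shows "Fq (zq_of (Fract P Q)) =
    (zq_of (Fract (pcompose P (monom 1 CARD('p))) (pcompose Q (monom 1 CARD('p)))) :: 'p::prime_card zqp)"
proof -
  have loc: "Fract P Q \<in> m_loc CARD('p)" by (rule m_locI[OF prime_CARD assms])
  then have sub: "q_subst CARD('p) (Fract P Q) \<in> m_loc CARD('p)" by (rule q_subst_loc[OF prime_CARD])
  have "Fq (zq_of x) = (zq_of (q_subst CARD('p) x) :: 'p zqp)"
    if "x \<in> m_loc CARD('p)" "q_subst CARD('p) x \<in> m_loc CARD('p)" for x
    using that by transfer (simp add: m_rel_refl[OF prime_CARD] m_cauchy_const[OF prime_CARD])
  from this[OF loc sub] show ?thesis
    by (simp only: q_subst_Fract[OF prime_CARD not_m_ideal_nz[OF prime_CARD assms]])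
qed

lemma zqp_abs_Fq_le: "zqp_abs (Fq x) \<le> zqp_abs x"
  by transfer (simp add: m_rel_refl[OF prime_CARD] m_cauchy_lim_q_subst_le[OF prime_CARD])

lemma continuous_Fq: "continuous_on UNIV (Fq :: 'p::prime_card zqp \<Rightarrow> 'p zqp)"
  unfolding continuous_on_eq_continuous_at[OF open_UNIV] isCont_def
proof (intro ballI metric_LIM_I)
  fix x :: "'p zqp" and e :: real assume "e > 0"
  moreover have "dist (Fq y) (Fq x) \<le> dist y x" for y :: "'p zqp"
    using zqp_abs_Fq_le[of "y - x"] Fq_add[of y "- x"] by (simp add: dist_zqp_def Fq_minus)
  ultimately show "\<exists>s>0. \<forall>y. y \<noteq> x \<and> dist y x < s \<longrightarrow> dist (Fq y) (Fq x) < e"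
    using le_less_trans by blast
qed

lemma Fq_unique:
  fixes G :: "'p::prime_card zqp \<Rightarrow> 'p zqp"
  assumes cont: "continuous_on UNIV G"
    and ext: "\<And>P Q. Q \<notin> m_ideal CARD('p) \<Longrightarrow> G (zq_of (Fract P Q)) =
      zq_of (Fract (pcompose P (monom 1 CARD('p))) (pcompose Q (monom 1 CARD('p))))"
  shows "G = Fq"
proof
  fix x :: "'p zqp"
  obtain X where X: "\<And>n. X n \<in> m_loc CARD('p)" "(\<lambda>n. zq_of (X n)) \<longlonglongrightarrow> x"
    using zq_of_dense[of x] by blast
  have "G (zq_of (X n)) = Fq (zq_of (X n))" for n
    using m_locE[OF prime_CARD X(1)[of n]] ext Fq_zq_of by metis
  then have "(\<lambda>n. G (zq_of (X n))) = (\<lambda>n. Fq (zq_of (X n)))" by blast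
  moreover have "(\<lambda>n. G (zq_of (X n))) \<longlonglongrightarrow> G x"
    using continuous_on_tendsto_compose[OF cont X(2)] by simp
  moreover have "(\<lambda>n. Fq (zq_of (X n))) \<longlonglongrightarrow> Fq x"
    using continuous_on_tendsto_compose[OF continuous_Fq X(2)] by simp
  ultimately show "G x = Fq x" using LIMSEQ_unique by metis
qed


section \<open>Power series over the completion\<close>

definition q_elt :: "'p::prime_card zqp" where
  "q_elt = zq_of (to_fract qvar)"

definition gauss_norm :: "'p::prime_card zqp fps \<Rightarrow> real" where
  "gauss_norm f = (SUP n. zqp_abs (fps_nth f n))"

text \<open>The localization of the polynomial ring at \<open>S = {Q. |Q(0)| = 1}\<close>, inside the power series
  ring: \<open>g = P/Q\<close> is expressed as \<open>g Q = P\<close>, since \<open>Q\<close> is a unit there.\<close>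

definition poly_loc :: "'p::prime_card zqp fps set" where
  "poly_loc = {g. \<exists>P Q. zqp_abs (poly Q 0) = 1 \<and> g * fps_of_poly Q = fps_of_poly P}"

text \<open>The power series ring is complete for the Gauss norm, so the completion of \<open>poly_loc\<close> is
  its closure: the set of all limits of sequences in \<open>poly_loc\<close>.\<close>

definition E_zqp :: "'p::prime_card zqp fps set" where
  "E_zqp = {g. \<exists>u. (\<forall>k. u k \<in> poly_loc) \<and> (\<lambda>k. gauss_norm (g - u k)) \<longlonglongrightarrow> 0}"

definition sigma_q :: "'p::prime_card zqp fps \<Rightarrow> 'p zqp fps" where
  "sigma_q f = Abs_fps (\<lambda>n. fps_nth f n * q_elt ^ n)"

definition Frob :: "'p::prime_card zqp fps \<Rightarrow> 'p zqp fps" where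
  "Frob f = Abs_fps (\<lambda>k. if CARD('p) dvd k then Fq (fps_nth f (k div CARD('p))) else 0)"


section \<open>Operators and strong Frobenius structures\<close>

text \<open>An operator of order \<open>n\<close> is given by its coefficients \<open>a 1, \<dots>, a n\<close>; the leading
  coefficient is 1.\<close>

definition qdiff_op ::
    "nat \<Rightarrow> (nat \<Rightarrow> 'p::prime_card zqp fps) \<Rightarrow> 'p zqp fps \<Rightarrow> 'p zqp fps" where
  "qdiff_op n a f = (sigma_q ^^ n) f + (\<Sum>i=1..n. a i * (sigma_q ^^ (n - i)) f)"

definition companion :: "nat \<Rightarrow> (nat \<Rightarrow> 'p::prime_card zqp fps) \<Rightarrow> 'p zqp fps mat" where
  "companion n a = mat n n (\<lambda>(i, j).
     if i = n - 1 then - a (n - j) else if j = i + 1 then 1 else 0)"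

definition GL_E :: "nat \<Rightarrow> 'p::prime_card zqp fps mat set" where
  "GL_E n = {H \<in> carrier_mat n n. elements_mat H \<subseteq> E_zqp \<and>
     (\<exists>K\<in>carrier_mat n n. elements_mat K \<subseteq> E_zqp \<and> H * K = 1\<^sub>m n \<and> K * H = 1\<^sub>m n)}"

definition strong_frobenius :: "nat \<Rightarrow> (nat \<Rightarrow> 'p::prime_card zqp fps) \<Rightarrow> nat \<Rightarrow> bool" where
  "strong_frobenius n a h \<longleftrightarrow> h > 0 \<and>
     (\<exists>H\<in>GL_E n. map_mat sigma_q H * map_mat (Frob ^^ h) (companion n a) = companion n a * H)"


section \<open>The valuation ring of the fraction field\<close>

definition theta :: "'p::prime_card zqp fract set" where
  "theta = {x. fract_abs zqp_abs x \<le> 1}"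

definition phi_p :: "'p::prime_card zqp" where
  "phi_p = (\<Sum>i<CARD('p). q_elt ^ i)"

definition phi_theta :: "'p::prime_card zqp fract set" where
  "phi_theta = {to_fract phi_p * x | x. x \<in> theta}"

definition series_over :: "'a::zero set \<Rightarrow> 'a fps set" where
  "series_over A = {f. \<forall>n. fps_nth f n \<in> A}"

definition frac_series :: "'a::idom fps \<Rightarrow> 'a fract fps" where
  "frac_series f = Abs_fps (\<lambda>n. to_fract (fps_nth f n))"

end

theory Submission
  imports Defs
begin

text \<open>
  Let \<open>A\<close> be the companion matrix, \<open>H\<close> the Frobenius structure, \<open>\<phi>\<close> the \<open>h\<close>-th power of Frobenius and
  \<open>F = (f, \<sigma> f, \<dots>, \<sigma>\<^sup>n\<^sup>-\<^sup>1 f)\<close>, so that \<open>\<sigma> F = A F\<close>. As \<open>Y \<mapsto> H \<phi>(Y)\<close> preserves the solutions of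
  \<open>\<sigma> Y = A Y\<close>, all \<open>Y\<^sub>i = M\<^sub>i \<phi>\<^sup>i(F)\<close> with \<open>M\<^sub>i = H \<phi>(H) \<cdots> \<phi>\<^sup>i\<^sup>-\<^sup>1(H)\<close> are solutions. The powers
  \<open>q\<^sup>m\<close> are distinct, so the solutions form a space of dimension at most \<open>n\<close> over the constants, and
  there is a nontrivial relation \<open>c\<^sub>0 Y\<^sub>0 + \<dots> + c\<^sub>n Y\<^sub>n = 0\<close>. Divide it by the \<open>c\<^sub>k\<close> of largest absolute
  value. The ideal generated by \<open>\<phi>\<^sub>p(q)\<close> consists of the elements of absolute value at most \<open>1/p\<close>
  and contains \<open>1 - q\<close>, so modulo it \<open>\<phi>\<^sup>i(F)\<close> is the vector with all entries \<open>\<phi>\<^sup>i(f)\<close>. Each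
  row of the relation thus becomes a congruence of the required shape, whose coefficients are
  \<open>c\<^sub>i / c\<^sub>k\<close> times the row sums of \<open>M\<^sub>i\<close>. Since \<open>M\<^sub>k\<close> is invertible, some row sum of \<open>M\<^sub>k\<close> does
  not vanish, and that row is chosen. This uses only \<open>d\<^sub>0, \<dots>, d\<^sub>n\<close>.
\<close>

no_notation fps_nth (infixl "$" 75)

section \<open>Absolute values\<close>

context ultra_abs
begin

lemma sum_le: "0 \<le> r \<Longrightarrow> (\<And>i. i \<in> S \<Longrightarrow> v (f i) \<le> r) \<Longrightarrow> v (sum f S) \<le> r"
proof (induction S rule: infinite_finite_induct)
  case (insert i S)
  then have "v (f i) \<le> r" "v (sum f S) \<le> r" by auto
  with insert(1,2) add_le[of "f i" "sum f S"] show ?case by simp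
qed simp_all

text \<open>The isosceles property: among the three sides of an ultrametric triangle the two longest
  are equal.\<close>

lemma abs_eq_if_dist_less: "v (x - y) < v y \<Longrightarrow> v x = v y"
  using add_le[of "x - y" y] add_le[of "y - x" x] diff_commute[of x y] by (auto simp: max_def split: if_splits)

end

section \<open>The embedding of Z[q] and the sizes of 1 - q^n and of the cyclotomic sum\<close>

lemma CARD_gt_1: "real CARD('p::prime_card) > 1"
  by (rule p_gt_1[OF prime_CARD])

lemma m_loc_to_fract: "to_fract P \<in> m_loc CARD('p::prime_card)"
  unfolding to_fract_def by (rule m_locI[OF prime_CARD not_m_ideal_1[OF prime_CARD]])

text \<open>A polynomial always lies in the localization, so the junk value of \<open>zq_of\<close>
  never occurs and the ring homomorphism laws hold without side conditions.\<close>

definition zq_poly :: "int poly \<Rightarrow> 'p::prime_card zqp" where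
  "zq_poly P = zq_of (to_fract P)"

lemma zqp_abs_zq_poly: "zqp_abs (zq_poly P :: 'p::prime_card zqp) = m_abs CARD('p) P"
  unfolding zq_poly_def zqp_abs_zq_of[OF m_loc_to_fract]
  by (simp add: to_fract_def q_abs_loc_Fract[OF prime_CARD] not_m_ideal_1[OF prime_CARD])

lemma zq_poly_add: "zq_poly (P + Q) = zq_poly P + zq_poly Q"
  by (simp add: zq_poly_def zq_of_add m_loc_to_fract)

lemma zq_poly_mult: "zq_poly (P * Q) = zq_poly P * zq_poly Q"
  by (simp add: zq_poly_def zq_of_mult m_loc_to_fract)

lemma zq_poly_0 [simp]: "zq_poly 0 = 0" and zq_poly_1 [simp]: "zq_poly 1 = 1"
  by (simp_all add: zq_poly_def zq_of_0 zq_of_1)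

lemma zq_poly_diff: "zq_poly (P - Q) = zq_poly P - zq_poly Q"
  by (simp add: eq_diff_eq flip: zq_poly_add)

lemma zq_poly_power: "zq_poly (P ^ n) = zq_poly P ^ n"
  by (induction n) (simp_all add: zq_poly_mult)

lemma zq_poly_sum: "zq_poly (sum f S) = (\<Sum>i\<in>S. zq_poly (f i))"
  by (induction S rule: infinite_finite_induct) (simp_all add: zq_poly_add)

lemma q_elt_eq: "q_elt = zq_poly qvar"
  by (simp add: q_elt_def zq_poly_def)

lemma q_elt_power: "q_elt ^ n = zq_poly (monom 1 n)"
  by (simp add: q_elt_eq zq_poly_power[symmetric] monom_altdef)

text \<open>The embedding preserves absolute values, hence is injective, and distinct monomials stay
  distinct. This later limits how many q^m are roots of one polynomial.\<close>

lemma inj_q_elt_power: "inj (\<lambda>n. (q_elt :: 'p::prime_card zqp) ^ n)"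
proof (rule injI)
  fix m n assume "(q_elt :: 'p zqp) ^ m = q_elt ^ n"
  then have "zqp_abs (zq_poly (monom 1 m - monom 1 n) :: 'p zqp) = 0"
    by (simp add: q_elt_power zq_poly_diff)
  then have "monom 1 m - monom (1 :: int) n = 0"
    unfolding zqp_abs_zq_poly using ultra_abs.zero_iff[OF ultra_abs_m_abs[OF prime_CARD]] by blast
  then have "coeff (monom 1 m) n = coeff (monom (1 :: int) n) n" by simp
  then show "m = n" by (simp split: if_splits)
qed

lemma zqp_abs_1_minus_q_elt: "zqp_abs (1 - q_elt :: 'p::prime_card zqp) \<le> 1 / real CARD('p)"
proof -
  have "1 - qvar \<in> m_pow CARD('p) (Suc 0)"
    unfolding m_pow_1 by (simp add: m_ideal_iff_poly[OF prime_CARD])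
  then have "m_abs CARD('p) (1 - qvar) \<le> 1 / real CARD('p) ^ Suc 0"
    by (simp only: m_abs_le_iff[OF prime_CARD])
  moreover have "1 - q_elt = (zq_poly (1 - qvar) :: 'p zqp)"
    by (simp only: q_elt_eq zq_poly_diff zq_poly_1)
  ultimately show ?thesis by (simp only: zqp_abs_zq_poly power_one_right One_nat_def[symmetric])
qed

text \<open>1 - q divides 1 - q^n with a cofactor of absolute value at most 1, so the bound is
  uniform in n.\<close>

lemma zqp_abs_1_minus_q_elt_power: "zqp_abs (1 - q_elt ^ n :: 'p::prime_card zqp) \<le> 1 / real CARD('p)"
proof -
  have "zqp_abs (1 - q_elt ^ n :: 'p zqp) = zqp_abs (1 - q_elt :: 'p zqp) * zqp_abs (\<Sum>i<n. q_elt ^ i :: 'p zqp)"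
    by (simp only: one_diff_power_eq zqp.mult)
  also have "\<dots> \<le> zqp_abs (1 - q_elt :: 'p zqp)"
    by (rule mult_right_le_one_le) (simp_all add: zqp.nonneg zqp_abs_le_1)
  finally show ?thesis using zqp_abs_1_minus_q_elt[where 'p = 'p] by linarith
qed

text \<open>The value at q = 1, which is the constant term of the expansion in q - 1, is p. It is
  divisible by p but not by p^2, so the polynomial lies in m but not in m^2.\<close>

lemma zqp_abs_phi_p: "zqp_abs (phi_p :: 'p::prime_card zqp) = 1 / real CARD('p)"
proof -
  let ?p = "CARD('p)" and ?f = "\<Sum>i<CARD('p). qvar ^ i"
  have p: "prime ?p" by (rule prime_CARD)
  have f1: "poly ?f 1 = int ?p" by (simp add: poly_sum)
  have "?f \<in> m_pow ?p 1"
    unfolding One_nat_def m_pow_1 m_ideal_iff_poly[OF p] f1 by simp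
  moreover have "\<not> (int ?p)\<^sup>2 dvd int ?p"
    using prime_gt_1_nat[OF p] by (simp add: power2_eq_square)
  then have "?f \<notin> m_pow ?p (Suc 1)"
    unfolding m_pow_iff wcond_def using f1
    by (auto simp: poly_0_coeff_0[symmetric] poly_pcompose numeral_2_eq_2 intro!: exI[of _ 0])
  ultimately have "m_abs ?p ?f = 1 / real ?p ^ 1" by (rule m_abs_eqI[OF p])
  moreover have "zqp_abs (phi_p :: 'p zqp) = m_abs ?p ?f"
    unfolding phi_p_def q_elt_eq zq_poly_power[symmetric] zq_poly_sum[symmetric]
    by (rule zqp_abs_zq_poly)
  ultimately show ?thesis by simp
qed

section \<open>The valuation ring of the fraction field\<close>

interpretation frac: ultra_abs "fract_abs zqp_abs :: 'p::prime_card zqp fract \<Rightarrow> real"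
  by (rule ultra_abs_fract_abs[OF ultra_abs_zqp_abs])

lemma fract_abs_to_fract [simp]: "fract_abs zqp_abs (to_fract x) = zqp_abs x"
  by (simp add: to_fract_def fract_abs_Fract[OF ultra_abs_zqp_abs])

text \<open>Dividing by \<open>phi_p\<close> multiplies absolute values by p, so the ideal is a
  ball. Congruences thereby become norm estimates.\<close>

lemma phi_theta_eq: "phi_theta = {x :: 'p::prime_card zqp fract. fract_abs zqp_abs x \<le> 1 / real CARD('p)}"
proof -
  let ?phi = "to_fract (phi_p :: 'p zqp)"
  have pos: "0 < real CARD('p)" using CARD_gt_1[where 'p = 'p] by linarith
  have phi: "fract_abs zqp_abs ?phi = 1 / real CARD('p)" by (simp add: zqp_abs_phi_p)
  then have nz: "?phi \<noteq> 0" using pos frac.zero_iff[of ?phi] by (metis less_numeral_extra(3) zero_less_divide_1_iff)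
  show ?thesis
  proof (intro equalityI subsetI)
    fix x :: "'p zqp fract" assume "x \<in> phi_theta"
    then show "x \<in> {x. fract_abs zqp_abs x \<le> 1 / real CARD('p)}"
      using pos by (auto simp: phi_theta_def theta_def frac.mult zqp_abs_phi_p divide_right_mono)
  next
    fix x :: "'p zqp fract" assume x: "x \<in> {x. fract_abs zqp_abs x \<le> 1 / real CARD('p)}"
    have eq: "x = ?phi * (x / ?phi)" using nz by simp
    have "x / ?phi \<in> theta"
    proof -
      have "fract_abs zqp_abs x = fract_abs zqp_abs ?phi * fract_abs zqp_abs (x / ?phi)"
        unfolding frac.mult[symmetric] using eq by (rule arg_cong)
      then show ?thesis using x pos by (simp add: theta_def zqp_abs_phi_p field_simps)
    qed
    then show "x \<in> phi_theta" using eq unfolding phi_theta_def by blast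
  qed
qed

text \<open>Approximate x by a fraction a/b with a and b outside m. Being outside m is a condition
  on the value at q = 1, which the substitution of q^p for q fixes; contractivity of
  \<open>Fq\<close> carries the result back to x. It keeps admissible denominators admissible under
  Frobenius.\<close>

lemma zqp_abs_Fq_eq_1:
  fixes x :: "'p::prime_card zqp"
  assumes "zqp_abs x = 1"
  shows "zqp_abs (Fq x) = 1"
proof -
  have p: "prime CARD('p)" by (rule prime_CARD)
  obtain X where X: "\<And>n. X n \<in> m_loc CARD('p)" "(\<lambda>n. zq_of (X n)) \<longlonglongrightarrow> x"
    using zq_of_dense[of x] by blast
  then obtain n where n: "dist (zq_of (X n)) x < 1"
    using metric_LIMSEQ_D[OF X(2), of 1] by auto
  define y where "y = (zq_of (X n) :: 'p zqp)"
  have y: "zqp_abs (y - x) < 1" using n by (simp add: dist_zqp_def y_def)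
  then have y1: "zqp_abs y = 1" using zqp.abs_eq_if_dist_less[of y x] assms by simp
  obtain a b where ab: "X n = Fract a b" "b \<notin> m_ideal CARD('p)"
    using m_locE[OF p X(1)[of n]] by metis
  have "a \<notin> m_ideal CARD('p)"
  proof
    assume "a \<in> m_ideal CARD('p)"
    then have "m_abs CARD('p) a \<le> 1 / real CARD('p)"
      using m_abs_le_iff[OF p, of a 1] by (simp add: m_pow_1)
    moreover have "m_abs CARD('p) a = 1"
      using y1 ab zqp_abs_zq_of[OF X(1)[of n]]
      by (simp add: y_def q_abs_loc_Fract[OF p])
    ultimately show False using CARD_gt_1[where 'p = 'p] by simp
  qed
  then have "zqp_abs (Fq y) = 1"
    using ab by (simp add: y_def Fq_zq_of zqp_abs_zq_of m_locI[OF p] not_m_ideal_pcompose[OF p]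
        q_abs_loc_Fract[OF p] m_abs_eq_1[OF p])
  moreover have "zqp_abs (Fq x - Fq y) < 1"
  proof -
    have "zqp_abs (Fq x - Fq y) = zqp_abs (Fq (x - y))"
      using Fq_add[of x "- y"] by (simp add: Fq_minus)
    also have "\<dots> \<le> zqp_abs (x - y)" by (rule zqp_abs_Fq_le)
    finally show ?thesis using y zqp.diff_commute[of x y] by simp
  qed
  ultimately show ?thesis using zqp.abs_eq_if_dist_less[of "Fq x" "Fq y"] by simp
qed


section \<open>Dilation and Frobenius on power series\<close>

lemma Fq_0: "Fq 0 = 0"
  using Fq_add[of 0 0] by (simp only: add_0_right add_cancel_right_right)

text \<open>Splits Frobenius into \<open>Fq\<close> on coefficients followed by the substitution of
  z^p for z; each factor is visibly multiplicative.\<close>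

lemma Frob_eq_compose: "Frob f = Abs_fps (\<lambda>n. Fq (fps_nth f n)) oo fps_X ^ CARD('p)"
  for f :: "'p::prime_card zqp fps"
  by (rule fps_ext) (simp add: Frob_def fps_nth_compose_X_power)

lemma Fq_sum: "Fq (sum f S) = (\<Sum>i\<in>S. Fq (f i))"
  by (induction S rule: infinite_finite_induct) (simp_all add: Fq_0 Fq_add)

lemma comm_ring_hom_Frob: "comm_ring_hom (Frob :: 'p::prime_card zqp fps \<Rightarrow> 'p zqp fps)"
proof
  fix f g :: "'p zqp fps"
  let ?m = "\<lambda>f. Abs_fps (\<lambda>n. Fq (fps_nth (f :: 'p zqp fps) n))"
  have "?m (f * g) = ?m f * ?m g"
    by (rule fps_ext) (simp add: fps_mult_nth Fq_sum Fq_mult)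
  then show "Frob (f * g) = Frob f * Frob g"
    unfolding Frob_eq_compose by (simp add: fps_compose_mult_distrib)
  show "Frob (f + g) = Frob f + Frob g"
    by (rule fps_ext) (simp add: Frob_def Fq_add)
  show "Frob (0 :: 'p zqp fps) = 0" "Frob (1 :: 'p zqp fps) = 1"
    by (rule fps_ext, auto simp: Frob_def Fq_0 Fq_1 elim!: dvdE)+
qed

lemma comm_ring_hom_funpow:
  fixes F :: "'a::comm_ring_1 \<Rightarrow> 'a"
  assumes "comm_ring_hom F"
  shows "comm_ring_hom (F ^^ k)"
proof -
  interpret comm_ring_hom F by fact
  show ?thesis
  proof (induction k)
    case (Suc k)
    interpret k: comm_ring_hom "F ^^ k" by fact
    show ?case by unfold_locales (simp_all add: hom_distribs)
  qed (unfold_locales, simp_all)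
qed

lemma sigma_q_nth [simp]: "fps_nth (sigma_q f) n = fps_nth f n * q_elt ^ n"
  by (simp add: sigma_q_def)

lemma comm_ring_hom_sigma_q: "comm_ring_hom (sigma_q :: 'p::prime_card zqp fps \<Rightarrow> 'p zqp fps)"
proof
  fix f g :: "'p zqp fps"
  show "sigma_q (f * g) = sigma_q f * sigma_q g"
  proof (rule fps_ext)
    fix n
    have "q_elt ^ n = (q_elt ^ i * q_elt ^ (n - i) :: 'p zqp)" if "i \<in> {0..n}" for i
      using that by (simp flip: power_add)
    then show "fps_nth (sigma_q (f * g)) n = fps_nth (sigma_q f * sigma_q g) n"
      unfolding fps_mult_nth sigma_q_nth sum_distrib_right by (intro sum.cong) (simp_all add: mult_ac)
  qed
qed (auto intro!: fps_ext simp: algebra_simps)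

lemma sigma_q_const [simp]: "sigma_q (fps_const c) = fps_const c"
  by (rule fps_ext) simp

lemma sigma_q_pow_nth: "fps_nth ((sigma_q ^^ k) f) n = fps_nth f n * (q_elt ^ n) ^ k"
  by (induction k) (simp_all add: mult_ac)

lemma Fq_q_elt: "Fq q_elt = (q_elt ^ CARD('p) :: 'p::prime_card zqp)"
proof -
  have "Fq q_elt = (Fq (zq_of (Fract qvar 1)) :: 'p zqp)"
    by (simp only: q_elt_def to_fract_def)
  also have "\<dots> = zq_of (Fract (monom 1 CARD('p)) 1)"
    by (simp add: Fq_zq_of not_m_ideal_1[OF prime_CARD] pcompose_one[OF prime_CARD] pcompose_pCons)
  finally show ?thesis
    by (simp only: q_elt_power zq_poly_def to_fract_def)
qed

lemma Fq_power: "Fq (x ^ n) = Fq x ^ n"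
  by (induction n) (simp_all add: Fq_1 Fq_mult)

text \<open>In either order the coefficient of z^(np) acquires the factor q^(np), because
  \<open>Fq\<close> sends q^n to q^(pn).\<close>

lemma Frob_sigma_q: "Frob (sigma_q f) = sigma_q (Frob f)"
  by (rule fps_ext)
    (auto simp: Frob_def Fq_mult Fq_power Fq_q_elt Fq_0 simp flip: power_mult)

lemma Frob_pow_sigma_q: "(Frob ^^ k) (sigma_q f) = sigma_q ((Frob ^^ k) f)"
  by (induction k) (simp_all add: Frob_sigma_q)


section \<open>The Gauss norm and the ring of analytic elements\<close>

text \<open>All coefficients have absolute value at most 1, so the supremum is taken over a bounded
  set.\<close>

lemma gauss_norm_le_iff: "gauss_norm f \<le> r \<longleftrightarrow> (\<forall>n. zqp_abs (fps_nth f n) \<le> r)"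
  unfolding gauss_norm_def
  by (subst cSUP_le_iff) (auto intro!: bdd_aboveI[of _ 1] simp: zqp_abs_le_1)

lemma gauss_norm_nonneg: "0 \<le> gauss_norm f"
  using gauss_norm_le_iff[of f "gauss_norm f"] zqp.nonneg order_trans by blast

lemma gauss_norm_add: "gauss_norm f \<le> r \<Longrightarrow> gauss_norm g \<le> r \<Longrightarrow> gauss_norm (f + g) \<le> r"
  unfolding gauss_norm_le_iff fps_add_nth using zqp.add_le by (metis max.boundedI order_trans)

lemma gauss_norm_mult:
  assumes "gauss_norm f \<le> r"
  shows "gauss_norm (g * f) \<le> r"
  unfolding gauss_norm_le_iff fps_mult_nth
proof (intro allI zqp.sum_le)
  show "0 \<le> r" using assms gauss_norm_nonneg[of f] by linarith
  fix n i
  have "zqp_abs (fps_nth g i * fps_nth f (n - i)) \<le> zqp_abs (fps_nth f (n - i))"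
    unfolding zqp.mult by (rule mult_left_le_one_le) (simp_all add: zqp.nonneg zqp_abs_le_1)
  also have "\<dots> \<le> r" using assms unfolding gauss_norm_le_iff by blast
  finally show "zqp_abs (fps_nth g i * fps_nth f (n - i)) \<le> r" .
qed

lemma gauss_norm_sum:
  assumes "0 \<le> r" "\<And>i. i \<in> S \<Longrightarrow> gauss_norm (f i) \<le> r"
  shows "gauss_norm (sum f S) \<le> r"
  using assms unfolding gauss_norm_le_iff fps_sum_nth by (auto intro: zqp.sum_le)

text \<open>Dilation is the identity modulo \<open>phi_p\<close>, since it multiplies each
  coefficient by a power of q and every such power is congruent to 1.\<close>

lemma gauss_norm_diff_sigma_q_pow:
  "gauss_norm (f - (sigma_q ^^ k) f) \<le> 1 / real CARD('p)" for f :: "'p::prime_card zqp fps"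
  unfolding gauss_norm_le_iff
proof
  fix n
  have "fps_nth (f - (sigma_q ^^ k) f) n = fps_nth f n * (1 - q_elt ^ (n * k))"
    by (simp add: sigma_q_pow_nth power_mult right_diff_distrib)
  then have "zqp_abs (fps_nth (f - (sigma_q ^^ k) f) n) \<le> zqp_abs (1 - q_elt ^ (n * k) :: 'p zqp)"
    by (simp add: zqp.mult mult_left_le_one_le zqp.nonneg zqp_abs_le_1)
  also have "\<dots> \<le> 1 / real CARD('p)" by (rule zqp_abs_1_minus_q_elt_power)
  finally show "zqp_abs (fps_nth (f - (sigma_q ^^ k) f) n) \<le> 1 / real CARD('p)" .
qed

lemma gauss_norm_Frob: "gauss_norm f \<le> r \<Longrightarrow> gauss_norm (Frob f) \<le> r"
  unfolding gauss_norm_le_iff Frob_def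
  using zqp_abs_Fq_le zqp.nonneg by (auto intro: order_trans)

section \<open>Closure of \<open>E_zqp\<close> under the ring operations and Frobenius\<close>

lemma E_zqp_iff: "g \<in> E_zqp \<longleftrightarrow> (\<forall>e>0. \<exists>u\<in>poly_loc. gauss_norm (g - u) \<le> e)"
proof
  assume "g \<in> E_zqp"
  then obtain u where u: "\<And>k. u k \<in> poly_loc" "(\<lambda>k. gauss_norm (g - u k)) \<longlonglongrightarrow> 0"
    unfolding E_zqp_def by blast
  show "\<forall>e>0. \<exists>u\<in>poly_loc. gauss_norm (g - u) \<le> e"
  proof (intro allI impI)
    fix e :: real assume "e > 0"
    then obtain k where "gauss_norm (g - u k) < e"
      using order_tendstoD(2)[OF u(2)] eventually_sequentially by (metis order_refl)
    with u(1) show "\<exists>u\<in>poly_loc. gauss_norm (g - u) \<le> e" by (meson less_imp_le)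
  qed
next
  assume *: "\<forall>e>0. \<exists>u\<in>poly_loc. gauss_norm (g - u) \<le> e"
  have "\<exists>u\<in>poly_loc. gauss_norm (g - u) \<le> inverse (real (Suc k))" for k
    using * by simp
  then obtain u where u: "\<And>k. u k \<in> poly_loc" "\<And>k. gauss_norm (g - u k) \<le> inverse (real (Suc k))"
    by metis
  have "(\<lambda>k. gauss_norm (g - u k)) \<longlonglongrightarrow> 0"
    by (rule tendsto_sandwich[OF _ _ tendsto_const LIMSEQ_inverse_real_of_nat])
      (use u(2) gauss_norm_nonneg in \<open>auto intro!: always_eventually\<close>)
  with u(1) show "g \<in> E_zqp" unfolding E_zqp_def by blast
qed

lemma poly_locI: "zqp_abs (poly Q 0) = 1 \<Longrightarrow> g * fps_of_poly Q = fps_of_poly P \<Longrightarrow> g \<in> poly_loc"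
  unfolding poly_loc_def by blast

lemma poly_loc_add:
  assumes "f \<in> poly_loc" "g \<in> poly_loc"
  shows "f + g \<in> poly_loc"
proof -
  obtain P Q R S where f: "zqp_abs (poly Q 0) = 1" "f * fps_of_poly Q = fps_of_poly P"
    and g: "zqp_abs (poly S 0) = 1" "g * fps_of_poly S = fps_of_poly R"
    using assms unfolding poly_loc_def by blast
  have "(f + g) * fps_of_poly (Q * S)
      = f * fps_of_poly Q * fps_of_poly S + g * fps_of_poly S * fps_of_poly Q"
    by (simp add: fps_of_poly_mult algebra_simps)
  also have "\<dots> = fps_of_poly (P * S + R * Q)"
    unfolding f g by (simp add: fps_of_poly_mult fps_of_poly_add)
  finally show ?thesis by (rule poly_locI[rotated]) (simp add: f g zqp.mult)
qed

lemma poly_loc_mult: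
  assumes "f \<in> poly_loc" "g \<in> poly_loc"
  shows "f * g \<in> poly_loc"
proof -
  obtain P Q R S where f: "zqp_abs (poly Q 0) = 1" "f * fps_of_poly Q = fps_of_poly P"
    and g: "zqp_abs (poly S 0) = 1" "g * fps_of_poly S = fps_of_poly R"
    using assms unfolding poly_loc_def by blast
  have "(f * g) * fps_of_poly (Q * S) = (f * fps_of_poly Q) * (g * fps_of_poly S)"
    by (simp add: fps_of_poly_mult mult_ac)
  also have "\<dots> = fps_of_poly (P * R)"
    unfolding f g by (simp add: fps_of_poly_mult)
  finally show ?thesis by (rule poly_locI[rotated]) (simp add: f g zqp.mult)
qed

lemma poly_loc_const: "fps_const c \<in> poly_loc"
  by (rule poly_locI[of 1 _ "[:c:]"]) simp_all

lemma Frob_fps_of_poly: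
  "Frob (fps_of_poly P) = fps_of_poly (pcompose (map_poly Fq P) (monom 1 CARD('p)))"
  for P :: "'p::prime_card zqp poly"
proof -
  have "Abs_fps (\<lambda>n. Fq (coeff P n)) = fps_of_poly (map_poly Fq P)"
    by (rule fps_ext) (simp add: coeff_map_poly Fq_0)
  then show ?thesis
    using prime_gt_0_nat[OF prime_CARD]
    by (simp add: Frob_eq_compose fps_of_poly_pcompose fps_of_poly_monom')
qed

text \<open>The new denominator has constant term \<open>Fq\<close> of the old one, which again has
  absolute value 1.\<close>

lemma poly_loc_Frob:
  assumes "f \<in> poly_loc"
  shows "Frob f \<in> poly_loc"
proof -
  interpret comm_ring_hom Frob by (rule comm_ring_hom_Frob)
  obtain P Q where f: "zqp_abs (poly Q 0) = 1" "f * fps_of_poly Q = fps_of_poly P"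
    using assms unfolding poly_loc_def by blast
  have "Frob f * Frob (fps_of_poly Q) = Frob (fps_of_poly P)"
    by (simp only: f flip: hom_mult)
  then show ?thesis unfolding Frob_fps_of_poly
    by (rule poly_locI[rotated])
      (use f(1) prime_gt_0_nat[OF prime_CARD] in
        \<open>simp add: poly_pcompose poly_monom poly_0_coeff_0 coeff_map_poly Fq_0 zqp_abs_Fq_eq_1\<close>)
qed

lemma E_zqp_const: "fps_const c \<in> E_zqp"
  unfolding E_zqp_iff using poly_loc_const[of c]
  by (auto intro!: bexI[of _ "fps_const c"] simp: gauss_norm_le_iff)

lemma E_zqp_0: "0 \<in> E_zqp" and E_zqp_1: "1 \<in> E_zqp"
  using E_zqp_const[of 0] E_zqp_const[of 1] by simp_all

lemma E_zqp_add:
  assumes "f \<in> E_zqp" "g \<in> E_zqp"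
  shows "f + g \<in> E_zqp"
  unfolding E_zqp_iff
proof (intro allI impI)
  fix e :: real assume "e > 0"
  then obtain u w where uw: "u \<in> poly_loc" "gauss_norm (f - u) \<le> e" "w \<in> poly_loc" "gauss_norm (g - w) \<le> e"
    using assms unfolding E_zqp_iff by meson
  have "gauss_norm (f + g - (u + w)) \<le> e"
    using gauss_norm_add[OF uw(2,4)] by (simp add: algebra_simps)
  with uw show "\<exists>u\<in>poly_loc. gauss_norm (f + g - u) \<le> e" using poly_loc_add by blast
qed

lemma E_zqp_mult:
  assumes "f \<in> E_zqp" "g \<in> E_zqp"
  shows "f * g \<in> E_zqp"
  unfolding E_zqp_iff
proof (intro allI impI)
  fix e :: real assume "e > 0"
  then obtain u w where uw: "u \<in> poly_loc" "gauss_norm (f - u) \<le> e" "w \<in> poly_loc" "gauss_norm (g - w) \<le> e"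
    using assms unfolding E_zqp_iff by meson
  \<comment> \<open>This sum telescopes to f g - u w.\<close>
  have "gauss_norm (f * (g - w) + w * (f - u)) \<le> e"
    using uw by (intro gauss_norm_add gauss_norm_mult)
  then have "gauss_norm (f * g - u * w) \<le> e" by (simp add: algebra_simps)
  with uw show "\<exists>u\<in>poly_loc. gauss_norm (f * g - u) \<le> e" using poly_loc_mult by blast
qed

lemma E_zqp_sum: "(\<And>i. i \<in> S \<Longrightarrow> f i \<in> E_zqp) \<Longrightarrow> sum f S \<in> E_zqp"
  by (induction S rule: infinite_finite_induct) (auto intro: E_zqp_add simp: E_zqp_0)

lemma E_zqp_Frob:
  assumes "f \<in> E_zqp"
  shows "Frob f \<in> E_zqp"
  unfolding E_zqp_iff
proof (intro allI impI)
  interpret comm_ring_hom Frob by (rule comm_ring_hom_Frob)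
  fix e :: real assume "e > 0"
  then obtain u where u: "u \<in> poly_loc" "gauss_norm (f - u) \<le> e"
    using assms unfolding E_zqp_iff by meson
  then show "\<exists>u\<in>poly_loc. gauss_norm (Frob f - u) \<le> e"
    using gauss_norm_Frob[OF u(2)] poly_loc_Frob by (auto simp: hom_minus)
qed

lemma E_zqp_Frob_pow: "f \<in> E_zqp \<Longrightarrow> (Frob ^^ k) f \<in> E_zqp"
  by (induction k) (simp_all add: E_zqp_Frob)


section \<open>Solutions of the difference equation\<close>

text \<open>Fewer equations (indexed by \<open>Z\<close>) than unknowns (indexed by
  \<open>I\<close>): Gaussian elimination on the equations, free of division so that it works over
  an integral domain.\<close>

lemma ex_linear_dependence:
  fixes v :: "'i \<Rightarrow> 'z \<Rightarrow> 'a::idom"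
  assumes "finite Z" "finite I" "card Z < card I"
  shows "\<exists>c. (\<exists>i\<in>I. c i \<noteq> 0) \<and> (\<forall>z\<in>Z. (\<Sum>i\<in>I. c i * v i z) = 0)"
  using assms
proof (induction Z arbitrary: I v rule: finite_induct)
  case empty
  then obtain i where "i \<in> I" by fastforce
  then show ?case by (intro exI[of _ "\<lambda>_. 1"]) auto
next
  case (insert z Z)
  show ?case
  proof (cases "\<forall>i\<in>I. v i z = 0")
    case True
    have "card Z < card I" using insert by simp
    then obtain c where "\<exists>i\<in>I. c i \<noteq> 0" "\<forall>z\<in>Z. (\<Sum>i\<in>I. c i * v i z) = 0"
      using insert.IH[OF insert.prems(1), of v] by blast
    with True show ?thesis by (intro exI[of _ c]) auto
  next
    case False
    then obtain k where k: "k \<in> I" "v k z \<noteq> 0" by blast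
    \<comment> \<open>Elimination with pivot \<open>v k z\<close>, cross-multiplied instead of
      divided; every \<open>w i\<close> vanishes at \<open>z\<close>.\<close>
    define w where "w i x = v k z * v i x - v i z * v k x" for i x
    have "card Z < card (I - {k})" using insert k by simp
    then obtain c where c: "\<exists>i\<in>I - {k}. c i \<noteq> 0"
      "\<And>x. x \<in> Z \<Longrightarrow> (\<Sum>i\<in>I - {k}. c i * w i x) = 0"
      using insert.IH[of "I - {k}" w] insert.prems(1) by blast
    \<comment> \<open>Collects the coefficient of each \<open>v i\<close> in the combination of the
      \<open>w i\<close>. Without zero divisors, a nonzero \<open>c i\<close> stays nonzero when
      multiplied by the pivot.\<close>
    define c' where "c' i = (if i = k then - (\<Sum>i\<in>I - {k}. c i * v i z) else c i * v k z)" for i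
    have "(\<Sum>i\<in>I. c' i * v i x) = (\<Sum>i\<in>I - {k}. c i * w i x)" for x
    proof -
      have "(\<Sum>i\<in>I. c' i * v i x) = c' k * v k x + (\<Sum>i\<in>I - {k}. c' i * v i x)"
        using insert.prems(1) k(1) by (rule sum.remove)
      also have "(\<Sum>i\<in>I - {k}. c' i * v i x) = (\<Sum>i\<in>I - {k}. c i * v k z * v i x)"
        by (rule sum.cong) (auto simp: c'_def)
      also have "c' k * v k x = - (\<Sum>i\<in>I - {k}. c i * v i z * v k x)"
        by (simp add: c'_def sum_distrib_right)
      finally show ?thesis by (simp add: w_def right_diff_distrib sum_subtractf mult_ac)
    qed
    moreover have "w i z = 0" for i by (simp add: w_def)
    moreover have "\<exists>i\<in>I. c' i \<noteq> 0" using c(1) k(2) by (auto simp: c'_def)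
    ultimately show ?thesis using c(2) by (intro exI[of _ c']) auto
  qed
qed

lemma sigma_q_pow_const [simp]: "(sigma_q ^^ k) (fps_const c) = fps_const c"
  by (induction k) simp_all

text \<open>Indexing by the power of \<open>sigma_q\<close> matches the columns of the last row of
  the companion matrix.\<close>

lemma qdiff_op_eq: "qdiff_op n a f = (sigma_q ^^ n) f + (\<Sum>j<n. a (n - j) * (sigma_q ^^ j) f)"
  unfolding qdiff_op_def
  by (rule arg_cong2[of _ _ _ _ "(+)"], rule refl,
      rule sum.reindex_bij_witness[of _ "\<lambda>j. n - j" "\<lambda>i. n - i"]) auto

text \<open>The operator is linear over the constants because \<open>sigma_q\<close> fixes
  them.\<close>

lemma qdiff_op_lincomb:
  assumes "\<And>i. i \<in> I \<Longrightarrow> qdiff_op n a (y i) = 0"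
  shows "qdiff_op n a (\<Sum>i\<in>I. fps_const (c i) * y i) = 0"
proof -
  have s: "(sigma_q ^^ k) (\<Sum>i\<in>I. fps_const (c i) * y i) = (\<Sum>i\<in>I. fps_const (c i) * (sigma_q ^^ k) (y i))" for k
  proof -
    interpret comm_ring_hom "sigma_q ^^ k"
      by (rule comm_ring_hom_funpow[OF comm_ring_hom_sigma_q])
    show ?thesis by (simp add: hom_sum hom_mult)
  qed
  have "qdiff_op n a (\<Sum>i\<in>I. fps_const (c i) * y i) = (\<Sum>i\<in>I. fps_const (c i) * qdiff_op n a (y i))"
    unfolding qdiff_op_eq s
    by (simp add: distrib_left sum.distrib sum_distrib_left mult.left_commute sum.swap[of _ I])
  then show ?thesis using assms by simp
qed

text \<open>At the lowest nonzero coefficient \<open>g\<^sub>m\<close> of a solution the equation reads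
  \<open>P(q\<^sup>m) g\<^sub>m = 0\<close>, where \<open>P\<close> is the characteristic polynomial at \<open>z = 0\<close>.\<close>

lemma qdiff_op_determined:
  fixes a :: "nat \<Rightarrow> 'p::prime_card zqp fps"
  shows "\<exists>Z. finite Z \<and> card Z \<le> n \<and> (\<forall>g. qdiff_op n a g = 0 \<longrightarrow> (\<forall>m\<in>Z. fps_nth g m = 0) \<longrightarrow> g = 0)"
proof -
  define P where "P = monom 1 n + (\<Sum>j<n. monom (fps_nth (a (n - j)) 0) j)"
  define R where "R = {x. poly P x = 0}"
  \<comment> \<open>The exponents at which a solution may start; there are at most n, as P is monic
    of degree n and m \<mapsto> q^m is injective.\<close>
  define Z where "Z = {m. poly P (q_elt ^ m) = 0}"
  have P_coeff: "coeff P i = (if i = n then 1 else if i < n then fps_nth (a (n - i)) 0 else 0)" for i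
    by (auto simp: P_def coeff_sum coeff_monom sum.delta' simp del: coeff_monom_Suc cong: sum.cong if_cong)
  then have "coeff P n \<noteq> 0" by simp
  then have nz: "P \<noteq> 0" by auto
  have deg: "degree P \<le> n" by (rule degree_le) (simp add: P_coeff)
  have R: "finite R" "card R \<le> n"
    using poly_roots_finite[OF nz] card_poly_roots_bound[OF nz] deg by (simp_all add: R_def)
  have im: "(\<lambda>m. q_elt ^ m) ` Z \<subseteq> R" by (auto simp: Z_def R_def)
  have inj: "inj_on (\<lambda>m. q_elt ^ m :: 'p zqp) Z" using inj_q_elt_power by (rule inj_on_subset) simp
  have "finite Z" by (rule inj_on_finite[OF inj im R(1)])
  moreover have "card Z \<le> n" using card_inj_on_le[OF inj im R(1)] R(2) by linarith
  moreover have "g = 0" if g: "qdiff_op n a g = 0" and gZ: "\<forall>m\<in>Z. fps_nth g m = 0" for g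
  proof (rule fps_ext)
    fix m
    show "fps_nth g m = fps_nth 0 m"
    proof (induction m rule: less_induct)
      case (less m)
      have "fps_nth (b * (sigma_q ^^ k) g) m = fps_nth b 0 * (q_elt ^ m) ^ k * fps_nth g m" for b k
      proof -
        \<comment> \<open>By induction the coefficients of \<open>g\<close> below \<open>m\<close>
          vanish, so only the constant term of \<open>b\<close> contributes.\<close>
        have "fps_nth (b * (sigma_q ^^ k) g) m = (\<Sum>i\<in>{0}. fps_nth b i * fps_nth ((sigma_q ^^ k) g) (m - i))"
          unfolding fps_mult_nth by (rule sum.mono_neutral_right) (auto simp: sigma_q_pow_nth less)
        then show ?thesis by (simp add: sigma_q_pow_nth)
      qed
      then have "fps_nth (qdiff_op n a g) m = poly P (q_elt ^ m) * fps_nth g m"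
        by (simp add: qdiff_op_eq P_def fps_sum_nth poly_sum poly_monom sigma_q_pow_nth
            distrib_right sum_distrib_right)
      then have "poly P (q_elt ^ m) * fps_nth g m = 0" by (simp add: g)
      then show ?case using gZ by (auto simp: Z_def)
    qed
  qed
  ultimately show ?thesis by blast
qed

text \<open>Solutions are determined by at most n coefficients. Some nontrivial combination of n + 1
  solutions kills all of these, and as a solution itself it must be zero.\<close>

lemma qdiff_op_solutions_dependent:
  fixes a :: "nat \<Rightarrow> 'p::prime_card zqp fps"
  assumes "\<And>i. i \<le> n \<Longrightarrow> qdiff_op n a (y i) = 0"
  obtains c where "\<exists>i\<le>n. c i \<noteq> 0" "(\<Sum>i\<le>n. fps_const (c i) * y i) = 0"
proof -
  obtain Z where Z: "finite Z" "card Z \<le> n"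
    "\<And>g. qdiff_op n a g = 0 \<Longrightarrow> \<forall>m\<in>Z. fps_nth g m = 0 \<Longrightarrow> g = 0"
    using qdiff_op_determined[of n a] by metis
  have "card Z < card {..n}" using Z(2) by simp
  then obtain c where c: "\<exists>i\<in>{..n}. c i \<noteq> 0" "\<forall>m\<in>Z. (\<Sum>i\<le>n. c i * fps_nth (y i) m) = 0"
    using ex_linear_dependence[OF Z(1) finite_atMost, of n "\<lambda>i. fps_nth (y i)"] by blast
  have "(\<Sum>i\<le>n. fps_const (c i) * y i) = 0"
    by (rule Z(3), rule qdiff_op_lincomb) (use c(2) assms in \<open>auto simp: fps_sum_nth\<close>)
  with c(1) show ?thesis by (intro that[of c]) auto
qed

section \<open>Scalar equation and companion system\<close>

definition companion_solution :: "nat \<Rightarrow> (nat \<Rightarrow> 'p::prime_card zqp fps) \<Rightarrow> 'p zqp fps vec \<Rightarrow> bool" where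
  "companion_solution n a Y \<longleftrightarrow> Y \<in> carrier_vec n \<and> map_vec sigma_q Y = companion n a *\<^sub>v Y"

lemma companion_carrier [simp]: "companion n a \<in> carrier_mat n n"
  by (simp add: companion_def)

lemma companion_mult_vec:
  assumes "Y \<in> carrier_vec n" "i < n"
  shows "(companion n a *\<^sub>v Y) $ i = (if i = n - 1 then - (\<Sum>j<n. a (n - j) * Y $ j) else Y $ (i + 1))"
proof -
  have "(companion n a *\<^sub>v Y) $ i = (\<Sum>j<n. companion n a $$ (i, j) * Y $ j)"
    using assms by (auto simp: companion_def scalar_prod_def lessThan_atLeast0 intro!: sum.cong)
  also have "\<dots> = (\<Sum>j<n. (if i = n - 1 then - (a (n - j) * Y $ j) else if j = i + 1 then Y $ j else 0))"
    using assms by (intro sum.cong) (auto simp: companion_def)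
  also have "\<dots> = (if i = n - 1 then - (\<Sum>j<n. a (n - j) * Y $ j) else Y $ (i + 1))"
    using assms by (auto simp: sum_negf)
  finally show ?thesis .
qed

lemma companion_solution_of_scalar:
  assumes "qdiff_op n a f = 0"
  shows "companion_solution n a (vec n (\<lambda>i. (sigma_q ^^ i) f))"
  unfolding companion_solution_def
proof (intro conjI eq_vecI)
  let ?F = "vec n (\<lambda>i. (sigma_q ^^ i) f)"
  fix i assume "i < dim_vec (companion n a *\<^sub>v ?F)"
  then have i: "i < n" by (simp add: companion_def)
  have "(sigma_q ^^ n) f = - (\<Sum>j<n. a (n - j) * (sigma_q ^^ j) f)"
    using assms unfolding qdiff_op_eq by (rule eq_neg_iff_add_eq_0[THEN iffD2])
  moreover have "(sigma_q ^^ n) f = sigma_q ((sigma_q ^^ (n - 1)) f)"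
    using i by (cases n) simp_all
  ultimately show "map_vec sigma_q ?F $ i = (companion n a *\<^sub>v ?F) $ i"
    using i by (subst companion_mult_vec) auto
qed (simp_all add: companion_def)

lemma companion_solution_step:
  assumes "companion_solution n a Y" "i < n"
  shows "sigma_q (Y $ i) = (if i = n - 1 then - (\<Sum>j<n. a (n - j) * Y $ j) else Y $ (i + 1))"
proof -
  have Y: "Y \<in> carrier_vec n" "map_vec sigma_q Y = companion n a *\<^sub>v Y"
    using assms(1) by (simp_all add: companion_solution_def)
  have "sigma_q (Y $ i) = map_vec sigma_q Y $ i" using Y(1) assms(2) by simp
  also have "\<dots> = (companion n a *\<^sub>v Y) $ i" by (simp only: Y(2))
  finally show ?thesis by (simp only: companion_mult_vec[OF Y(1) assms(2)])
qed

text \<open>Each row but the last says that the next entry is \<open>sigma_q\<close> of the current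
  one, so the first entry determines the vector.\<close>

lemma companion_solution_nth:
  assumes "companion_solution n a Y" "i < n"
  shows "Y $ i = (sigma_q ^^ i) (Y $ 0)"
  using assms(2)
proof (induction i)
  case (Suc i)
  then show ?case using companion_solution_step[OF assms(1), of i] by simp
qed simp

lemma qdiff_op_of_companion_solution:
  assumes "companion_solution n a Y" "n > 0"
  shows "qdiff_op n a (Y $ 0) = 0"
proof -
  have "sigma_q (Y $ (n - 1)) = - (\<Sum>j<n. a (n - j) * Y $ j)"
    using companion_solution_step[OF assms(1), of "n - 1"] assms(2) by simp
  moreover have "sigma_q (Y $ (n - 1)) = (sigma_q ^^ n) (Y $ 0)"
    using companion_solution_nth[OF assms(1), of "n - 1"] assms(2) by (cases n) simp_all
  moreover have "(\<Sum>j<n. a (n - j) * Y $ j) = (\<Sum>j<n. a (n - j) * (sigma_q ^^ j) (Y $ 0))"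
    by (intro sum.cong refl arg_cong2[of _ _ _ _ "(*)"] companion_solution_nth[OF assms(1)]) simp
  ultimately show ?thesis unfolding qdiff_op_eq by (metis add.left_inverse)
qed


section \<open>Iterating the Frobenius structure\<close>

locale frobenius_structure =
  fixes n h :: nat and a :: "nat \<Rightarrow> 'p::prime_card zqp fps" and H K :: "'p zqp fps mat"
  assumes H [simp]: "H \<in> carrier_mat n n" and H_E: "elements_mat H \<subseteq> E_zqp"
    and K [simp]: "K \<in> carrier_mat n n" and KH: "K * H = 1\<^sub>m n"
    and frob: "map_mat sigma_q H * map_mat (Frob ^^ h) (companion n a) = companion n a * H"
begin

abbreviation "\<phi> \<equiv> Frob ^^ h"

sublocale phi: comm_ring_hom \<phi>
  by (rule comm_ring_hom_funpow[OF comm_ring_hom_Frob])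

sublocale sigma: comm_ring_hom "sigma_q :: 'p zqp fps \<Rightarrow> 'p zqp fps"
  by (rule comm_ring_hom_sigma_q)

text \<open>Apply \<phi> to the system, using that it commutes with \<open>sigma_q\<close>; then
  multiply by \<open>sigma_q\<close> of \<open>H\<close> and trade \<phi>(A) for A by the Frobenius
  relation.\<close>

lemma companion_solution_frobenius:
  assumes "companion_solution n a Y"
  shows "companion_solution n a (H *\<^sub>v map_vec \<phi> Y)"
proof -
  let ?A = "companion n a" and ?v = "map_vec \<phi> Y"
  have Y: "Y \<in> carrier_vec n" "map_vec sigma_q Y = ?A *\<^sub>v Y"
    using assms by (simp_all add: companion_solution_def)
  have "map_vec sigma_q ?v = map_vec \<phi> (map_vec sigma_q Y)"
    by (rule eq_vecI) (simp_all add: Frob_pow_sigma_q)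
  also have "\<dots> = map_mat \<phi> ?A *\<^sub>v ?v"
    unfolding Y(2) by (rule phi.mult_mat_vec_hom[OF companion_carrier Y(1)])
  finally have "map_vec sigma_q (H *\<^sub>v ?v) = map_mat sigma_q H *\<^sub>v (map_mat \<phi> ?A *\<^sub>v ?v)"
    using Y(1) by (subst sigma.mult_mat_vec_hom[OF H]) simp_all
  also have "\<dots> = (?A * H) *\<^sub>v ?v"
    unfolding frob[symmetric]
    by (rule assoc_mult_mat_vec[symmetric, of _ n n _ n]) (use Y(1) in simp_all)
  also have "\<dots> = ?A *\<^sub>v (H *\<^sub>v ?v)"
    by (rule assoc_mult_mat_vec[of _ n n _ n]) (use Y(1) in simp_all)
  finally have "map_vec sigma_q (H *\<^sub>v ?v) = ?A *\<^sub>v (H *\<^sub>v ?v)" .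
  moreover have "H *\<^sub>v ?v \<in> carrier_vec n"
    using Y(1) by (intro mult_mat_vec_carrier[OF H]) simp
  ultimately show ?thesis by (simp add: companion_solution_def)
qed

text \<open>The product \<open>M\<^sub>i\<close>, with the new factor on the left so that one more
  step is Y \<mapsto> H \<phi>(Y).\<close>

primrec iter :: "nat \<Rightarrow> 'p zqp fps mat" where
  "iter 0 = 1\<^sub>m n"
| "iter (Suc i) = H * map_mat \<phi> (iter i)"

lemma iter_carrier [simp]: "iter i \<in> carrier_mat n n"
  by (induction i) (auto intro!: mult_carrier_mat[OF H])

lemma dims [simp]: "dim_row H = n" "dim_col H = n" "dim_row (iter i) = n" "dim_col (iter i) = n"
  using carrier_matD[OF H] carrier_matD[OF iter_carrier] by auto

lemma iter_mat_sum:
  assumes "r < n" "s < n"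
  shows "iter (Suc i) $$ (r, s) = (\<Sum>j<n. H $$ (r, j) * \<phi> (iter i $$ (j, s)))"
  using assms by (auto simp: scalar_prod_def lessThan_atLeast0 intro!: sum.cong)

lemma iter_E: "r < n \<Longrightarrow> s < n \<Longrightarrow> iter i $$ (r, s) \<in> E_zqp"
proof (induction i arbitrary: r s)
  case 0
  then show ?case by (simp add: E_zqp_0 E_zqp_1)
next
  case (Suc i)
  have "H $$ (r, j) \<in> E_zqp" if "j < n" for j
    using H_E elements_matI[OF H Suc.prems(1) that refl] by blast
  then show ?case unfolding iter_mat_sum[OF Suc.prems]
    using Suc by (intro E_zqp_sum E_zqp_mult E_zqp_Frob_pow) auto
qed

text \<open>If N inverts \<open>iter i\<close> on the left, then \<phi>(N) K inverts H
  \<phi>(\<open>iter i\<close>).\<close>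

lemma iter_left_inverse: "\<exists>N\<in>carrier_mat n n. N * iter i = 1\<^sub>m n"
proof (induction i)
  case (Suc i)
  then obtain N where N: "N \<in> carrier_mat n n" "N * iter i = 1\<^sub>m n" by blast
  let ?m = "map_mat \<phi>"
  have G: "?m (iter i) \<in> carrier_mat n n" by simp
  then have HG: "H * ?m (iter i) \<in> carrier_mat n n" by (rule mult_carrier_mat[OF H])
  have "?m N * K * (H * ?m (iter i)) = ?m N * (K * (H * ?m (iter i)))"
    by (rule assoc_mult_mat[OF _ K HG]) (use N in simp)
  also have "K * (H * ?m (iter i)) = K * H * ?m (iter i)"
    by (rule assoc_mult_mat[OF K H G, symmetric])
  also have "\<dots> = ?m (iter i)"
    unfolding KH by (rule left_mult_one_mat[OF G])
  also have "?m N * ?m (iter i) = 1\<^sub>m n"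
    unfolding phi.mat_hom_mult[OF N(1) iter_carrier, symmetric] N(2) by (rule phi.mat_hom_one)
  finally have "?m N * K * iter (Suc i) = 1\<^sub>m n" by simp
  moreover have "?m N * K \<in> carrier_mat n n" using N by auto
  ultimately show ?case by blast
qed (auto intro!: bexI[of _ "1\<^sub>m n"])

lemma companion_solution_iter:
  assumes "companion_solution n a F"
  shows "companion_solution n a (iter i *\<^sub>v map_vec (\<phi> ^^ i) F)"
proof (induction i)
  case 0
  have "map_vec (\<phi> ^^ 0) F = F" by (rule eq_vecI) simp_all
  then have "iter 0 *\<^sub>v map_vec (\<phi> ^^ 0) F = F"
    using assms by (simp only: iter.simps companion_solution_def one_mult_mat_vec)
  then show ?case using assms by (simp only:)
next
  case (Suc i)
  have F: "F \<in> carrier_vec n" using assms by (simp add: companion_solution_def)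
  let ?G = "map_vec (\<phi> ^^ i) F"
  have "map_vec \<phi> ?G = map_vec (\<phi> ^^ Suc i) F" by (rule eq_vecI) simp_all
  then have "H *\<^sub>v map_vec \<phi> (iter i *\<^sub>v ?G) = H *\<^sub>v (map_mat \<phi> (iter i) *\<^sub>v map_vec (\<phi> ^^ Suc i) F)"
    using phi.mult_mat_vec_hom[OF iter_carrier, of ?G i] F by simp
  also have "\<dots> = iter (Suc i) *\<^sub>v map_vec (\<phi> ^^ Suc i) F"
    unfolding iter.simps by (rule assoc_mult_mat_vec[symmetric, of _ n n _ n]) (use F in auto)
  finally show ?case using companion_solution_frobenius[OF Suc] by (simp only:)
qed

text \<open>The coefficient that \<phi>^i(f) receives in row r once all entries of \<phi>^i(F) are
  identified with it.\<close>

definition row_sum :: "nat \<Rightarrow> nat \<Rightarrow> 'p zqp fps" where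
  "row_sum i r = (\<Sum>j<n. iter i $$ (r, j))"

lemma row_sum_E: "r < n \<Longrightarrow> row_sum i r \<in> E_zqp"
  unfolding row_sum_def by (intro E_zqp_sum iter_E) auto

text \<open>The first row of a left inverse combines the row sums of \<open>iter i\<close> into the
  first row sum of the identity matrix, which is 1. So they cannot all have Gauss norm at most
  1/p.\<close>

lemma row_sum_unit:
  assumes "n > 0"
  obtains r where "r < n" "\<not> gauss_norm (row_sum i r) \<le> 1 / real CARD('p)"
proof -
  obtain N where N: "N \<in> carrier_mat n n" "N * iter i = 1\<^sub>m n" using iter_left_inverse by blast
  have "(\<Sum>r<n. N $$ (0, r) * row_sum i r) = (\<Sum>s<n. \<Sum>r<n. N $$ (0, r) * iter i $$ (r, s))"
    unfolding row_sum_def sum_distrib_left by (rule sum.swap)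
  also have "\<dots> = (\<Sum>s<n. 1\<^sub>m n $$ (0, s))"
  proof (rule sum.cong)
    fix s assume "s \<in> {..<n}"
    then show "(\<Sum>r<n. N $$ (0, r) * iter i $$ (r, s)) = 1\<^sub>m n $$ (0, s)"
      unfolding N(2)[symmetric] using carrier_matD[OF N(1)] assms
      by (auto simp: scalar_prod_def lessThan_atLeast0 intro!: sum.cong)
  qed simp
  also have "\<dots> = 1" using assms by simp
  finally have one: "(\<Sum>r<n. N $$ (0, r) * row_sum i r) = 1" .
  show ?thesis
  proof (rule ccontr)
    assume "\<not> thesis"
    then have "gauss_norm (row_sum i r) \<le> 1 / real CARD('p)" if "r < n" for r
      using that \<open>r < n \<Longrightarrow> _ \<Longrightarrow> thesis\<close> by blast
    then have "gauss_norm (1 :: 'p zqp fps) \<le> 1 / real CARD('p)"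
      unfolding one[symmetric] by (intro gauss_norm_sum gauss_norm_mult) auto
    then have "zqp_abs (fps_nth (1 :: 'p zqp fps) 0) \<le> 1 / real CARD('p)"
      unfolding gauss_norm_le_iff by blast
    then show False using CARD_gt_1[where 'p = 'p] by simp
  qed
qed

lemma row_sum_congruence:
  assumes "r < n"
  shows "gauss_norm (row_sum i r * (\<phi> ^^ i) f
    - (iter i *\<^sub>v map_vec (\<phi> ^^ i) (vec n (\<lambda>j. (sigma_q ^^ j) f))) $ r) \<le> 1 / real CARD('p)"
proof -
  have comm: "(\<phi> ^^ i) ((sigma_q ^^ j) f) = (sigma_q ^^ j) ((\<phi> ^^ i) f)" for j
    by (induction j) (simp_all add: funpow_mult Frob_pow_sigma_q)
  have "(iter i *\<^sub>v map_vec (\<phi> ^^ i) (vec n (\<lambda>j. (sigma_q ^^ j) f))) $ r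
      = (\<Sum>j<n. iter i $$ (r, j) * (sigma_q ^^ j) ((\<phi> ^^ i) f))"
    using assms
    by (auto simp: scalar_prod_def lessThan_atLeast0 comm intro!: sum.cong)
  then have "row_sum i r * (\<phi> ^^ i) f
      - (iter i *\<^sub>v map_vec (\<phi> ^^ i) (vec n (\<lambda>j. (sigma_q ^^ j) f))) $ r
    = (\<Sum>j<n. iter i $$ (r, j) * ((\<phi> ^^ i) f - (sigma_q ^^ j) ((\<phi> ^^ i) f)))"
    by (simp add: row_sum_def sum_distrib_right right_diff_distrib sum_subtractf)
  also have "gauss_norm \<dots> \<le> 1 / real CARD('p)"
    by (intro gauss_norm_sum gauss_norm_mult gauss_norm_diff_sigma_q_pow) simp
  finally show ?thesis .
qed

text \<open>The relation is found for the first entries only; applying \<open>sigma_q ^^ r\<close>,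
  which fixes constants, yields it for entry r with the same \<open>c\<close>. The row can therefore
  be chosen afterwards.\<close>

lemma row_relation:
  assumes "qdiff_op n a f = 0" "n > 0"
  obtains c where "\<exists>i\<le>n. c i \<noteq> 0"
    "\<And>r. r < n \<Longrightarrow> (\<Sum>i\<le>n. fps_const (c i) *
       (iter i *\<^sub>v map_vec (\<phi> ^^ i) (vec n (\<lambda>j. (sigma_q ^^ j) f))) $ r) = 0"
proof -
  define Y where "Y i = iter i *\<^sub>v map_vec (\<phi> ^^ i) (vec n (\<lambda>j. (sigma_q ^^ j) f))" for i
  have Y: "companion_solution n a (Y i)" for i
    unfolding Y_def by (rule companion_solution_iter[OF companion_solution_of_scalar[OF assms(1)]])
  obtain c where c: "\<exists>i\<le>n. c i \<noteq> 0" "(\<Sum>i\<le>n. fps_const (c i) * Y i $ 0) = 0"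
    by (rule qdiff_op_solutions_dependent[of n a "\<lambda>i. Y i $ 0"])
      (rule qdiff_op_of_companion_solution[OF Y assms(2)])
  have "(\<Sum>i\<le>n. fps_const (c i) * Y i $ r) = 0" if "r < n" for r
  proof -
    interpret r: comm_ring_hom "sigma_q ^^ r :: 'p zqp fps \<Rightarrow> _"
      by (rule comm_ring_hom_funpow[OF comm_ring_hom_sigma_q])
    have "(\<Sum>i\<le>n. fps_const (c i) * Y i $ r) = (sigma_q ^^ r) (\<Sum>i\<le>n. fps_const (c i) * Y i $ 0)"
      by (simp add: r.hom_sum r.hom_mult companion_solution_nth[OF Y that])
    then show ?thesis by (simp add: c(2))
  qed
  with c(1) show ?thesis unfolding Y_def by (rule that)
qed

end

section \<open>Passage to the fraction field and proof of the theorem\<close>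

lemma frobenius_structure_ex:
  assumes "strong_frobenius n a h"
  obtains H K where "frobenius_structure n h a H K"
  using assms unfolding strong_frobenius_def GL_E_def frobenius_structure_def by blast

lemma frac_series_nth [simp]: "fps_nth (frac_series f) n = to_fract (fps_nth f n)"
  by (simp add: frac_series_def)

lemma to_fract_sum: "to_fract (sum f S) = (\<Sum>i\<in>S. to_fract (f i))"
  by (induction S rule: infinite_finite_induct) simp_all

lemma frac_series_mult: "frac_series (f * g) = frac_series f * frac_series g"
  by (rule fps_ext) (simp add: fps_mult_nth to_fract_sum)

theorem theorem1p3:
  fixes n h :: nat
    and a :: "nat \<Rightarrow> 'p::prime_card zqp fps"
    and f :: "'p zqp fps"
  assumes coeffs: "\<forall>i\<in>{1..n}. a i \<in> E_zqp"
    and sol: "qdiff_op n a f = 0"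
    and frob: "strong_frobenius n a h"
  shows "\<exists>(d :: nat \<Rightarrow> 'p zqp fract fps) (c :: 'p zqp).
    (\<forall>i\<le>n\<^sup>2. d i \<in> series_over theta) \<and> c \<noteq> 0 \<and>
    (\<exists>i\<le>n\<^sup>2. d i \<notin> series_over phi_theta) \<and>
    (\<forall>i\<le>n\<^sup>2. fps_const (to_fract c) * d i \<in> frac_series ` E_zqp) \<and>
    (\<Sum>i\<le>n\<^sup>2. d i * frac_series ((Frob ^^ (i * h)) f)) \<in> series_over phi_theta"
proof (cases "n = 0")
  case True
  \<comment> \<open>For order 0 the operator is the identity, so f = 0 and d_0 = 1 works.\<close>
  let ?one = "\<lambda>_::nat. 1 :: 'p zqp fract fps"
  have f0: "f = 0" using sol True by (simp add: qdiff_op_eq)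
  have "fps_nth (1 :: 'p zqp fract fps) 0 \<notin> phi_theta"
    using CARD_gt_1[where 'p = 'p] by (simp add: phi_theta_eq)
  then have "1 \<notin> series_over (phi_theta :: 'p zqp fract set)"
    unfolding series_over_def by blast
  moreover have "1 \<in> series_over (theta :: 'p zqp fract set)"
    by (simp add: series_over_def theta_def)
  moreover have "1 \<in> frac_series ` (E_zqp :: 'p zqp fps set)"
    by (rule image_eqI[OF _ E_zqp_1], rule fps_ext) simp
  moreover have "frac_series f = 0" by (rule fps_ext) (simp add: f0)
  moreover have "0 \<in> series_over (phi_theta :: 'p zqp fract set)"
    by (simp add: series_over_def phi_theta_eq)
  ultimately show ?thesis
    using True by (intro exI[of _ ?one] exI[of _ 1]) simp
next
  case False
  obtain H K where "frobenius_structure n h a H K" using frobenius_structure_ex[OF frob] .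
  then interpret frobenius_structure n h a H K .
  let ?p = "real CARD('p)"
  define y where "y i r = (iter i *\<^sub>v map_vec (\<phi> ^^ i) (vec n (\<lambda>j. (sigma_q ^^ j) f))) $ r" for i r
  obtain c where c: "\<exists>i\<le>n. c i \<noteq> 0" "\<And>r. r < n \<Longrightarrow> (\<Sum>i\<le>n. fps_const (c i) * y i r) = 0"
    unfolding y_def using row_relation[OF sol] False by blast
  define B where "B = Max ((\<lambda>i. zqp_abs (c i)) ` {..n})"
  have "B \<in> (\<lambda>i. zqp_abs (c i)) ` {..n}" unfolding B_def by (rule Max_in) auto
  then obtain k where k: "k \<le> n" "B = zqp_abs (c k)" by blast
  have c_le: "zqp_abs (c i) \<le> zqp_abs (c k)" if "i \<le> n" for i
    unfolding k(2)[symmetric] B_def using that by (intro Max_ge) auto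
  have nz: "c k \<noteq> 0"
  proof
    assume "c k = 0"
    then have "c i = 0" if "i \<le> n" for i
      using c_le[OF that] zqp.nonneg[of "c i"] zqp.zero_iff[of "c i"] by simp
    with c(1) show False by blast
  qed
  then have pos: "zqp_abs (c k) > 0" using zqp.nonneg[of "c k"] zqp.zero_iff[of "c k"] by linarith
  obtain r where r: "r < n" "\<not> gauss_norm (row_sum k r) \<le> 1 / ?p"
    using row_sum_unit[of k] False by blast
  \<comment> \<open>The normalized relation in row r, padded by zeros from n + 1 up to n^2. The
    constant clearing denominators is \<open>c k\<close>.\<close>
  define d where "d i = (if i \<le> n then fps_const (Fract (c i) (c k)) * frac_series (row_sum i r) else 0)" for i
  have scale: "to_fract (c k) * Fract (c i) (c k) = to_fract (c i)" for i
    using nz by (simp add: to_fract_def eq_fract)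
  have "fract_abs zqp_abs (Fract (c i) (c k)) \<le> 1" if "i \<le> n" for i
    using pos c_le[OF that] by (simp add: fract_abs_Fract[OF ultra_abs_zqp_abs nz])
  then have "d i \<in> series_over theta" for i
    by (auto simp: d_def series_over_def theta_def frac.mult zqp_abs_le_1 zqp.nonneg intro!: mult_le_one)
  moreover have "d k \<notin> series_over phi_theta"
  proof
    \<comment> \<open>At index k the scalar factor is 1, so \<open>d k\<close> is the row sum chosen
      to have norm above 1/p.\<close>
    have "Fract (c k) (c k) = 1" using nz by (simp add: One_fract_def eq_fract)
    moreover assume "d k \<in> series_over phi_theta"
    ultimately have "\<forall>m. zqp_abs (fps_nth (row_sum k r) m) \<le> 1 / ?p"
      using k(1) by (simp add: d_def series_over_def phi_theta_eq)
    with r(2) show False by (simp add: gauss_norm_le_iff)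
  qed
  moreover have "fps_const (to_fract (c k)) * d i \<in> frac_series ` E_zqp" for i
  proof (cases "i \<le> n")
    case True
    have "fps_const (to_fract (c k)) * d i = frac_series (fps_const (c i) * row_sum i r)"
      by (rule fps_ext) (simp add: d_def True scale flip: mult.assoc)
    then show ?thesis using E_zqp_mult[OF E_zqp_const row_sum_E[OF r(1)]] by blast
  next
    case False
    then have "fps_const (to_fract (c k)) * d i = frac_series 0"
      by (intro fps_ext) (simp add: d_def)
    then show ?thesis using E_zqp_0 by blast
  qed
  moreover have "(\<Sum>i\<le>n\<^sup>2. d i * frac_series ((Frob ^^ (i * h)) f)) \<in> series_over phi_theta"
  proof -
    have "n \<le> n\<^sup>2" by (simp add: power2_eq_square)
    then have "(\<Sum>i\<le>n\<^sup>2. d i * frac_series ((Frob ^^ (i * h)) f))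
        = (\<Sum>i\<le>n. d i * frac_series ((\<phi> ^^ i) f))"
      by (intro sum.mono_neutral_cong_right) (auto simp: d_def funpow_mult mult.commute)
    also have "\<dots> \<in> series_over phi_theta"
      unfolding series_over_def
    proof (intro CollectI allI)
      fix m
      let ?t = "fps_nth (\<Sum>i\<le>n. d i * frac_series ((\<phi> ^^ i) f)) m"
      \<comment> \<open>Multiplying by \<open>c k\<close> brings the estimate back to the completed
        ring.\<close>
      have "to_fract (c k) * ?t = (\<Sum>i\<le>n. to_fract (c k) * Fract (c i) (c k) *
          to_fract (fps_nth (row_sum i r * (\<phi> ^^ i) f) m))"
        by (simp add: fps_sum_nth d_def sum_distrib_left mult.assoc flip: frac_series_mult frac_series_nth)
      also have "\<dots> = to_fract (\<Sum>i\<le>n. c i * fps_nth (row_sum i r * (\<phi> ^^ i) f) m)"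
        unfolding scale to_fract_sum by simp
      \<comment> \<open>Subtracts the exact relation among the solutions, leaving terms that are
        small by \<open>row_sum_congruence\<close>.\<close>
      also have "(\<Sum>i\<le>n. c i * fps_nth (row_sum i r * (\<phi> ^^ i) f) m)
          = (\<Sum>i\<le>n. c i * fps_nth (row_sum i r * (\<phi> ^^ i) f - y i r) m)"
        using arg_cong[OF c(2)[OF r(1)], of "\<lambda>g. fps_nth g m"]
        by (simp add: fps_sum_nth right_diff_distrib sum_subtractf)
      finally have "fract_abs zqp_abs (to_fract (c k) * ?t)
          = fract_abs zqp_abs (to_fract (\<Sum>i\<le>n. c i * fps_nth (row_sum i r * (\<phi> ^^ i) f - y i r) m))"
        by (rule arg_cong)
      then have "zqp_abs (c k) * fract_abs zqp_abs ?t
          = zqp_abs (\<Sum>i\<le>n. c i * fps_nth (row_sum i r * (\<phi> ^^ i) f - y i r) m)"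
        unfolding frac.mult fract_abs_to_fract .
      also have "\<dots> \<le> zqp_abs (c k) * (1 / ?p)"
      proof (rule zqp.sum_le)
        fix i assume "i \<in> {..n}"
        moreover have "zqp_abs (fps_nth (row_sum i r * (\<phi> ^^ i) f - y i r) m) \<le> 1 / ?p"
          using row_sum_congruence[OF r(1), of i f] unfolding gauss_norm_le_iff y_def by blast
        ultimately show "zqp_abs (c i * fps_nth (row_sum i r * (\<phi> ^^ i) f - y i r) m)
            \<le> zqp_abs (c k) * (1 / ?p)"
          unfolding zqp.mult by (intro mult_mono c_le zqp.nonneg) auto
      qed (simp add: zqp.nonneg)
      finally show "?t \<in> phi_theta"
        unfolding phi_theta_eq using pos by (simp only: mult_le_cancel_left_pos mem_Collect_eq)
    qed
    finally show ?thesis .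
  qed
  moreover have "k \<le> n\<^sup>2" using k(1) by (simp add: power2_eq_square le_trans[OF _ le_square])
  ultimately show ?thesis using nz by blast
qed

end
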